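(* Let $Y$ be a $GL$-stable subset of $\mathbf{Hilb}_{p(t)}^{n}$. (i) If $L\in\mathbf B_{S_m}^{q}\cap\mathbf{Hilb}_{p(t)}^{n}$ and the relation $\mathrm{vs}(L)\prec\!\!\prec(\mathbf G_Y)_m$ does not hold, then $\mathrm{vs}(L)\notin Y$. (ii) If $V$ is a $K$-point of $\mathbf{Hilb}_{p(t)}^{n}$ and the relation $\mathrm{vs}(\mathbf{gin}(V))\prec\!\!\prec(\mathbf G_Y)_m$ does not hold, then $V\notin Y$.
   Context: $K$ is an infinite field, $S=K[x_0,\dots,x_n]$ with the standard grading, $S_m$ is its degree $m$ component, a term is a monic monomial, $\prec$ is a term order on $S$ with $x_0\prec\dots\prec x_n$. $\mathbf{Hilb}_{p(t)}^{n}$ is the Hilbert scheme of closed subschemes of $\mathbb P^n_K$ with Hilbert polynomial $p(t)$; $r$ is the Gotzmann number of $p(t)$ (the smallest integer such that the saturated ideals of all such subschemes are $r$-regular). Fix $m\ge r$, $q=\binom{n+m}{n}-p(m)$. $\mathbf{Hilb}_{p(t)}^{n}$ is regarded as a closed subscheme of the Grassmannian $\mathbf{Gr}_{S_m}^{q}$ of $q$-dimensional subspaces of $S_m$ by sending a subscheme with saturated ideal $I$ to $I_m$; the Grassmannian is embedded in $\mathbb P(\wedge^qS_m)$ by Plücker. $\mathbf T_{S_m}^{q}$ is the set of $\tau_1\wedge\dots\wedge\tau_q$ with $\tau_i$ terms in $S_m$, $\tau_1\succ\dots\succ\tau_q$, totally ordered by: $\tau_1\wedge\dots\wedge\tau_q\prec\sigma_1\wedge\dots\wedge\sigma_q$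 iff for some $j$, $\tau_i=\sigma_i$ for $i<j$ and $\tau_j\prec\sigma_j$. For $L=\tau_1\wedge\dots\wedge\tau_q$, $U_L\subseteq\mathbf{Gr}_{S_m}^{q}$ is the open set where the Plücker coordinate $\Delta_L$ is invertible, $\mathrm{vs}(L)=\langle\tau_1,\dots,\tau_q\rangle$. $\mathrm{GL}=\mathrm{GL}_K(n+1)$ acts on $S$ by $g(f)=f(\sum_j g_{0j}x_j,\dots,\sum_j g_{nj}x_j)$ and correspondingly on $\wedge^qS_m$ and $\mathbf{Gr}_{S_m}^{q}$; $\mathcal O(W)=\{g(V):V\in W,\ g\in\mathrm{GL}\}$. $L$ is Borel if $g(L)\in\langle L\rangle$ for every upper-triangular $g\in\mathrm{GL}$; $\mathbf B_{S_m}^{q}$ is the set of Borel terms and $\mathbf B_{S_m}^{q}\cap\mathbf{Hilb}_{p(t)}^{n}$ is the set of Borel terms $L$ with $\mathrm{vs}(L)\in\mathbf{Hilb}_{p(t)}^{n}$. For a non-empty set of points $W$, $\mathbf{gin}(W):=\max_\prec\{L\in\mathbf T_{S_m}^{q}:U_L\cap\mathcal O(W)\neq\emptyset\}$, and $\mathbf{gin}(V):=\mathbf{gin}(\{V\})$. A $GL$-stable subset is a non-empty closed irreducible subset of $\mathbf{Hilb}_{p(t)}^{n}$ stable under $\mathrm{GL}$. For such $Y$, the double-generic initial ideal is $\mathbf G_Y:=(I_{\mathrm{vs}(\mathbf{gin}(Y))})^{\mathrm{sat}}$, where $I_V$ is the ideal of $S$ generated by $V\subseteq S_m$ and sat denotes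 saturation with respect to $(x_0,\dots,x_n)$; it does not depend on $m\ge r$. For subspaces $V,V'$ of $S_m$ spanned by sets $A,B$ of $q$ terms each, $V\prec\!\!\prec V'$ means there is a bijection $\omega:A\to B$ with $a\preceq\omega(a)$ for every $a\in A$. *)

theory Defs
  imports
    "HOL-Library.Poly_Mapping"
    "HOL-Computational_Algebra.Polynomial"
    "Jordan_Normal_Form.Determinant"
begin

section \<open>The polynomial ring\<close>

text \<open>
  A term (monic monomial) is its exponent vector. The ring \<open>S = K[x_0, ..., x_n]\<close> is the
  subset \<open>polys n\<close> of the ring of polynomials in the variables \<open>x_0, x_1, x_2, ...\<close>; subspaces
  and ideals of \<open>S\<close> are subsets of it.
\<close>

type_synonym trm = "nat \<Rightarrow>\<^sub>0 nat"
type_synonym 'a mpol = "trm \<Rightarrow>\<^sub>0 'a"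

definition tdeg :: "('v \<Rightarrow>\<^sub>0 nat) \<Rightarrow> nat" where
  "tdeg t = (\<Sum>v\<in>Poly_Mapping.keys t. Poly_Mapping.lookup t v)"

definition trms :: "nat \<Rightarrow> trm set" where
  "trms n = {t. Poly_Mapping.keys t \<subseteq> {..n}}"

definition trms_deg :: "nat \<Rightarrow> nat \<Rightarrow> trm set" where
  "trms_deg n m = {t \<in> trms n. tdeg t = m}"

definition var_trm :: "nat \<Rightarrow> trm" where
  "var_trm i = Poly_Mapping.single i 1"

definition polys :: "nat \<Rightarrow> 'a::field mpol set" where
  "polys n = {f. Poly_Mapping.keys f \<subseteq> trms n}"

definition polys_deg :: "nat \<Rightarrow> nat \<Rightarrow> 'a::field mpol set" where
  "polys_deg n m = {f. Poly_Mapping.keys f \<subseteq> trms_deg n m}"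

definition const :: "'a::field \<Rightarrow> 'a mpol" where
  "const c = Poly_Mapping.single 0 c"

definition mon :: "trm \<Rightarrow> 'a::field mpol" where
  "mon t = Poly_Mapping.single t 1"

definition smul :: "'a::field \<Rightarrow> 'a mpol \<Rightarrow> 'a mpol" where
  "smul c f = const c * f"

interpretation mp: vector_space "smul :: 'a::field \<Rightarrow> 'a mpol \<Rightarrow> 'a mpol"
proof
  fix a b :: 'a and f g :: "'a mpol"
  show "smul a (f + g) = smul a f + smul a g"
    by (simp add: smul_def distrib_left)
  show "smul (a + b) f = smul a f + smul b f"
    by (simp add: smul_def const_def Poly_Mapping.single_add distrib_right)
  show "smul a (smul b f) = smul (a * b) f"
    by (simp add: smul_def const_def mult.assoc [symmetric] Poly_Mapping.mult_single)
  show "smul 1 f = f"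
    by (simp add: smul_def const_def)
qed

definition term_order :: "nat \<Rightarrow> (trm \<Rightarrow> trm \<Rightarrow> bool) \<Rightarrow> bool" where
  "term_order n prec \<longleftrightarrow>
     irreflp_on (trms n) prec \<and> transp_on (trms n) prec \<and> totalp_on (trms n) prec \<and>
     (\<forall>t\<in>trms n. t \<noteq> 0 \<longrightarrow> prec 0 t) \<and>
     (\<forall>s\<in>trms n. \<forall>t\<in>trms n. \<forall>u\<in>trms n. prec s t \<longrightarrow> prec (s + u) (t + u))"

section \<open>Homogeneous ideals\<close>

definition is_ideal :: "nat \<Rightarrow> 'a::field mpol set \<Rightarrow> bool" where
  "is_ideal n I \<longleftrightarrow> I \<subseteq> polys n \<and> 0 \<in> I \<and> (\<forall>f\<in>I. \<forall>g\<in>I. f + g \<in> I) \<and>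
     (\<forall>h\<in>polys n. \<forall>f\<in>I. h * f \<in> I)"

definition ideal_gen :: "nat \<Rightarrow> 'a::field mpol set \<Rightarrow> 'a mpol set" where
  "ideal_gen n A = \<Inter> {I. is_ideal n I \<and> A \<subseteq> I}"

definition hom_comp :: "nat \<Rightarrow> 'a::field mpol \<Rightarrow> 'a mpol" where
  "hom_comp d f =
     (\<Sum>t\<in>{t \<in> Poly_Mapping.keys f. tdeg t = d}. Poly_Mapping.single t (Poly_Mapping.lookup f t))"

definition homogeneous_ideal :: "nat \<Rightarrow> 'a::field mpol set \<Rightarrow> bool" where
  "homogeneous_ideal n I \<longleftrightarrow> is_ideal n I \<and> (\<forall>f\<in>I. \<forall>d. hom_comp d f \<in> I)"

text \<open>
  The saturation of \<open>I\<close> is the union over \<open>k\<close> of \<open>I : (x_0, ..., x_n)^k\<close>, and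
  \<open>(x_0, ..., x_n)^k\<close> is generated by the terms of degree \<open>k\<close>.
\<close>

definition sat :: "nat \<Rightarrow> 'a::field mpol set \<Rightarrow> 'a mpol set" where
  "sat n I = {f \<in> polys n. \<exists>k. \<forall>t\<in>trms_deg n k. mon t * f \<in> I}"

definition hilb_fun :: "nat \<Rightarrow> 'a::field mpol set \<Rightarrow> nat \<Rightarrow> int" where
  "hilb_fun n I t = int (mp.dim (polys_deg n t :: 'a mpol set)) - int (mp.dim (I \<inter> polys_deg n t))"

text \<open>
  Closed subschemes of \<open>P^n\<close> with Hilbert polynomial \<open>p\<close> are given by their saturated ideals.
\<close>

definition subschemes :: "nat \<Rightarrow> rat poly \<Rightarrow> 'a::field mpol set set" where
  "subschemes n p = {I. homogeneous_ideal n I \<and> sat n I = I \<and>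
     (\<exists>t0. \<forall>t\<ge>t0. rat_of_int (hilb_fun n I t) = poly p (rat_of_nat t))}"

section \<open>Castelnuovo--Mumford regularity\<close>

definition vecs :: "nat \<Rightarrow> nat \<Rightarrow> 'a::field mpol vec set" where
  "vecs n k = {v \<in> carrier_vec k. \<forall>i<k. v $ i \<in> polys n}"

text \<open>
  A minimal graded free resolution \<open>... \<rightarrow> F_1 \<rightarrow> F_0 \<rightarrow> I \<rightarrow> 0\<close>, where \<open>F_i\<close> is the direct sum of
  \<open>S(- a i j)\<close> for \<open>j < b i\<close>, \<open>F_0 \<rightarrow> I\<close> is the row \<open>\<phi>\<close> of generators, and \<open>F_(i+1) \<rightarrow> F_i\<close> is
  multiplication by the matrix \<open>M i\<close>. All maps have degree \<open>0\<close>, so the entry \<open>(j, k)\<close> of \<open>M i\<close>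
  is zero or homogeneous of degree \<open>a (i+1) k - a i j\<close>; by minimality it has no constant term.
\<close>

definition minimal_resolution ::
  "nat \<Rightarrow> 'a::field mpol set \<Rightarrow> (nat \<Rightarrow> nat) \<Rightarrow> (nat \<Rightarrow> nat \<Rightarrow> nat) \<Rightarrow>
    'a mpol vec \<Rightarrow> (nat \<Rightarrow> 'a mpol mat) \<Rightarrow> bool"
  where
  "minimal_resolution n I b a \<phi> M \<longleftrightarrow>
     \<phi> \<in> carrier_vec (b 0) \<and>
     (\<forall>j<b 0. \<phi> $ j \<in> polys_deg n (a 0 j)) \<and>
     (\<forall>i. M i \<in> carrier_mat (b i) (b (Suc i))) \<and>
     (\<forall>i. \<forall>j<b i. \<forall>k<b (Suc i). \<forall>t\<in>Poly_Mapping.keys (M i $$ (j, k)).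
        t \<in> trms n \<and> tdeg t + a i j = a (Suc i) k) \<and>
     (\<forall>i. \<forall>j<b i. \<forall>k<b (Suc i). Poly_Mapping.lookup (M i $$ (j, k)) 0 = 0) \<and>
     (\<lambda>v. scalar_prod \<phi> v) ` vecs n (b 0) = I \<and>
     (\<lambda>w. M 0 *\<^sub>v w) ` vecs n (b 1) = {v \<in> vecs n (b 0). scalar_prod \<phi> v = 0} \<and>
     (\<forall>i. (\<lambda>w. M (Suc i) *\<^sub>v w) ` vecs n (b (Suc (Suc i))) =
        {v \<in> vecs n (b (Suc i)). M i *\<^sub>v v = 0\<^sub>v (b i)})"

definition regular :: "nat \<Rightarrow> nat \<Rightarrow> 'a::field mpol set \<Rightarrow> bool" where
  "regular n r I \<longleftrightarrow> (\<exists>b a \<phi> M. minimal_resolution n I b a \<phi> M \<and> (\<forall>i. \<forall>j<b i. a i j \<le> r + i))"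

text \<open>
  Nonzero ideals of \<open>S\<close> have nonnegative regularity, so \<open>r\<close> may range over the natural numbers;
  this also fixes the convention \<open>r = 0\<close> when the zero ideal is the only one considered.
\<close>

definition is_gotzmann_number :: "'a::field itself \<Rightarrow> nat \<Rightarrow> rat poly \<Rightarrow> nat \<Rightarrow> bool" where
  "is_gotzmann_number K n p r \<longleftrightarrow>
     (\<forall>I\<in>(subschemes n p :: 'a mpol set set). regular n r I) \<and>
     (\<forall>r'<r. \<exists>I\<in>(subschemes n p :: 'a mpol set set). \<not> regular n r' I)"

section \<open>Exterior power, Grassmannian, Hilbert scheme\<close>

text \<open>The term \<open>\<tau>_1 \<and> ... \<and> \<tau>_q\<close> of the exterior power is the decreasing list of the \<open>\<tau>_i\<close>.\<close>

definition ext_trms :: "(trm \<Rightarrow> trm \<Rightarrow> bool) \<Rightarrow> nat \<Rightarrow> nat \<Rightarrow> nat \<Rightarrow> trm list set" where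
  "ext_trms prec n m q =
     {L. length L = q \<and> set L \<subseteq> trms_deg n m \<and> sorted_wrt (\<lambda>s t. prec t s) L}"

definition ext_less :: "(trm \<Rightarrow> trm \<Rightarrow> bool) \<Rightarrow> trm list \<Rightarrow> trm list \<Rightarrow> bool" where
  "ext_less prec L L' \<longleftrightarrow>
     (\<exists>j. j < length L \<and> j < length L' \<and> (\<forall>i<j. L ! i = L' ! i) \<and> prec (L ! j) (L' ! j))"

text \<open>
  Elements of the exterior power are represented by their coordinates with respect to the
  basis \<open>ext_trms\<close>; the coordinates of \<open>f_1 \<and> ... \<and> f_q\<close> are the maximal minors of the
  coefficient matrix.
\<close>

definition wedge ::
  "(trm \<Rightarrow> trm \<Rightarrow> bool) \<Rightarrow> nat \<Rightarrow> nat \<Rightarrow> nat \<Rightarrow> 'a::field mpol list \<Rightarrow> trm list \<Rightarrow> 'a" where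
  "wedge prec n m q fs L =
     (if L \<in> ext_trms prec n m q
      then det (mat q q (\<lambda>(i, j). Poly_Mapping.lookup (fs ! i) (L ! j))) else 0)"

definition vs :: "trm list \<Rightarrow> 'a::field mpol set" where
  "vs L = mp.span (mon ` set L)"

definition grass :: "nat \<Rightarrow> nat \<Rightarrow> nat \<Rightarrow> 'a::field mpol set set" where
  "grass n m q = {V. mp.subspace V \<and> V \<subseteq> polys_deg n m \<and> mp.dim V = q}"

definition hilb :: "nat \<Rightarrow> rat poly \<Rightarrow> nat \<Rightarrow> nat \<Rightarrow> 'a::field mpol set set" where
  "hilb n p m q = {V \<in> grass n m q. \<exists>I\<in>subschemes n p. V = I \<inter> polys_deg n m}"

text \<open>
  The Pluecker coordinates of \<open>V\<close>, for some chosen basis of \<open>V\<close>. They are determined up to a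
  common nonzero factor, and only the vanishing of homogeneous polynomials in them is used.
\<close>

definition plucker ::
  "(trm \<Rightarrow> trm \<Rightarrow> bool) \<Rightarrow> nat \<Rightarrow> nat \<Rightarrow> nat \<Rightarrow> 'a::field mpol set \<Rightarrow> trm list \<Rightarrow> 'a" where
  "plucker prec n m q V =
     wedge prec n m q (SOME fs. distinct fs \<and> mp.independent (set fs) \<and> mp.span (set fs) = V)"

definition U_open ::
  "(trm \<Rightarrow> trm \<Rightarrow> bool) \<Rightarrow> nat \<Rightarrow> nat \<Rightarrow> nat \<Rightarrow> trm list \<Rightarrow> 'a::field mpol set set" where
  "U_open prec n m q L = {V \<in> grass n m q. plucker prec n m q V L \<noteq> 0}"

section \<open>Points over an extension field, Zariski topology, group action\<close>

text \<open>
  The base field is \<open>'k\<close>. Points of the Grassmannian and of the Hilbert scheme over \<open>'k\<close> are taken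
  with values in an arbitrary extension field \<open>emb :: 'k \<Rightarrow> 'a\<close>, and closed sets are the zero loci
  of homogeneous polynomials in the Pluecker coordinates with coefficients in \<open>'k\<close>.
  With \<open>'a = 'k\<close> and \<open>emb = id\<close> this is the space of \<open>'k\<close>-points with its Zariski topology. If
  \<open>'a\<close> is algebraically closed of infinite transcendence degree over \<open>'k\<close>, then every point of the
  scheme comes from an \<open>'a\<close>-point, and the closed (irreducible) subsets correspond exactly to the
  closed (irreducible) subsets of the underlying space of the scheme.
\<close>

definition eval_poly ::
  "('k::field \<Rightarrow> 'a::field) \<Rightarrow> ((trm list \<Rightarrow>\<^sub>0 nat) \<Rightarrow>\<^sub>0 'k) \<Rightarrow> (trm list \<Rightarrow> 'a) \<Rightarrow> 'a" where
  "eval_poly emb F x =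
     (\<Sum>u\<in>Poly_Mapping.keys F. emb (Poly_Mapping.lookup F u) *
        (\<Prod>L\<in>Poly_Mapping.keys u. x L ^ Poly_Mapping.lookup u L))"

definition plucker_forms ::
  "(trm \<Rightarrow> trm \<Rightarrow> bool) \<Rightarrow> nat \<Rightarrow> nat \<Rightarrow> nat \<Rightarrow> ((trm list \<Rightarrow>\<^sub>0 nat) \<Rightarrow>\<^sub>0 'k::field) set" where
  "plucker_forms prec n m q =
     {F. \<exists>d. \<forall>u\<in>Poly_Mapping.keys F. Poly_Mapping.keys u \<subseteq> ext_trms prec n m q \<and> tdeg u = d}"

definition zariski_closed ::
  "('k::field \<Rightarrow> 'a::field) \<Rightarrow> (trm \<Rightarrow> trm \<Rightarrow> bool) \<Rightarrow> nat \<Rightarrow> nat \<Rightarrow> nat \<Rightarrow> 'a mpol set set \<Rightarrow> bool"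
  where
  "zariski_closed emb prec n m q C \<longleftrightarrow>
     (\<exists>\<F>\<subseteq>plucker_forms prec n m q.
        C = {V \<in> grass n m q. \<forall>F\<in>\<F>. eval_poly emb F (plucker prec n m q V) = 0})"

definition zariski_irreducible ::
  "('k::field \<Rightarrow> 'a::field) \<Rightarrow> (trm \<Rightarrow> trm \<Rightarrow> bool) \<Rightarrow> nat \<Rightarrow> nat \<Rightarrow> nat \<Rightarrow> 'a mpol set set \<Rightarrow> bool"
  where
  "zariski_irreducible emb prec n m q Y \<longleftrightarrow> Y \<noteq> {} \<and>
     (\<forall>C D. zariski_closed emb prec n m q C \<and> zariski_closed emb prec n m q D \<and> Y \<subseteq> C \<union> D \<longrightarrow>
        Y \<subseteq> C \<or> Y \<subseteq> D)"

definition GL :: "nat \<Rightarrow> 'k::field mat set" where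
  "GL n = {g \<in> carrier_mat (n + 1) (n + 1). invertible_mat g}"

definition act :: "nat \<Rightarrow> 'a::field mat \<Rightarrow> 'a mpol \<Rightarrow> 'a mpol" where
  "act n g f =
     (\<Sum>t\<in>Poly_Mapping.keys f. const (Poly_Mapping.lookup f t) *
        (\<Prod>i\<in>Poly_Mapping.keys t.
           (\<Sum>j\<le>n. const (g $$ (i, j)) * mon (var_trm j)) ^ Poly_Mapping.lookup t i))"

definition orbits ::
  "('k::field \<Rightarrow> 'a::field) \<Rightarrow> nat \<Rightarrow> 'a mpol set set \<Rightarrow> 'a mpol set set" where
  "orbits emb n W = {act n (map_mat emb g) ` V | V g. V \<in> W \<and> g \<in> GL n}"

definition extend_scalars :: "('k::field \<Rightarrow> 'a::field) \<Rightarrow> 'k mpol set \<Rightarrow> 'a mpol set" where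
  "extend_scalars emb V = mp.span (Poly_Mapping.map emb ` V)"

definition GL_stable ::
  "('k::field \<Rightarrow> 'a::field) \<Rightarrow> (trm \<Rightarrow> trm \<Rightarrow> bool) \<Rightarrow> nat \<Rightarrow> rat poly \<Rightarrow> nat \<Rightarrow> nat \<Rightarrow>
    'a mpol set set \<Rightarrow> bool"
  where
  "GL_stable emb prec n p m q Y \<longleftrightarrow>
     (\<exists>C. zariski_closed emb prec n m q C \<and> Y = C \<inter> hilb n p m q) \<and>
     zariski_irreducible emb prec n m q Y \<and>
     (\<forall>g\<in>GL n. \<forall>V\<in>Y. act n (map_mat emb g) ` V \<in> Y)"

text \<open>\<open>L\<close> is Borel if \<open>g(L)\<close> is a multiple of \<open>L\<close> for every upper triangular \<open>g\<close>.\<close>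

definition borel_trms ::
  "'k::field itself \<Rightarrow> (trm \<Rightarrow> trm \<Rightarrow> bool) \<Rightarrow> nat \<Rightarrow> nat \<Rightarrow> nat \<Rightarrow> trm list set" where
  "borel_trms K prec n m q = {L \<in> ext_trms prec n m q.
     \<forall>g::'k mat. g \<in> GL n \<and> upper_triangular g \<longrightarrow>
       (\<exists>c. wedge prec n m q (map (\<lambda>t. act n g (mon t)) L) =
            (\<lambda>L'. c * wedge prec n m q (map mon L) L'))}"

section \<open>Generic initial extensor and double-generic initial ideal\<close>

definition gin ::
  "('k::field \<Rightarrow> 'a::field) \<Rightarrow> (trm \<Rightarrow> trm \<Rightarrow> bool) \<Rightarrow> nat \<Rightarrow> nat \<Rightarrow> nat \<Rightarrow> 'a mpol set set \<Rightarrow> trm list"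
  where
  "gin emb prec n m q W =
     (let \<L> = {L \<in> ext_trms prec n m q. U_open prec n m q L \<inter> orbits emb n W \<noteq> {}}
      in THE L. L \<in> \<L> \<and> (\<forall>L'\<in>\<L>. L' = L \<or> ext_less prec L' L))"

definition double_gin ::
  "('k::field \<Rightarrow> 'a::field) \<Rightarrow> (trm \<Rightarrow> trm \<Rightarrow> bool) \<Rightarrow> nat \<Rightarrow> nat \<Rightarrow> nat \<Rightarrow> 'a mpol set set \<Rightarrow>
    'k mpol set"
  where
  "double_gin emb prec n m q Y = sat n (ideal_gen n (vs (gin emb prec n m q Y)))"

definition dominated ::
  "(trm \<Rightarrow> trm \<Rightarrow> bool) \<Rightarrow> nat \<Rightarrow> nat \<Rightarrow> nat \<Rightarrow> 'a::field mpol set \<Rightarrow> 'a mpol set \<Rightarrow> bool" where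
  "dominated prec n m q V V' \<longleftrightarrow>
     (\<exists>A B. A \<subseteq> trms_deg n m \<and> B \<subseteq> trms_deg n m \<and>
        finite A \<and> finite B \<and> card A = q \<and> card B = q \<and>
        V = mp.span (mon ` A) \<and> V' = mp.span (mon ` B) \<and>
        (\<exists>\<omega>. bij_betw \<omega> A B \<and> (\<forall>a\<in>A. prec a (\<omega> a) \<or> a = \<omega> a)))"

end

theory Submission
  imports Defs "HOL-Library.Function_Algebras"
begin

text \<open>
  For a point \<open>V\<close> of the Grassmannian every term \<open>L\<close> with nonzero Pluecker coordinate \<open>\<Delta>\<^sub>L(V)\<close> is
  dominated componentwise by the list of leading terms of \<open>V\<close>. If \<open>V \<in> Y\<close> and \<open>\<Delta>\<^sub>L(V) \<noteq> 0\<close>, then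
  irreducibility of \<open>Y\<close> gives a point \<open>W \<in> Y\<close> at which the coordinates of both \<open>L\<close> and
  \<open>gin Y\<close> are nonzero. Maximality forces the leading terms of \<open>W\<close> to be \<open>gin Y\<close>, which therefore
  dominates \<open>L\<close>. Both parts are instances of this, with \<open>L\<close> the given Borel term and
  \<open>L = gin V\<close>, respectively.

  It remains to see that \<open>vs (gin Y)\<close> is the whole degree \<open>m\<close> component of \<open>\<^bold>G\<^sub>Y\<close>. Take a point \<open>W\<close> of
  \<open>Y\<close> with leading terms \<open>gin Y\<close>, with saturated ideal \<open>I\<close>. The saturation \<open>J\<close> of the ideal of leading
  terms of \<open>I\<close>, taken over the base field, has the same Hilbert polynomial by Dickson's lemma, so \<open>J\<close> is
  \<open>r\<close>-regular. The Hilbert function of an \<open>r\<close>-regular ideal is a polynomial from degree \<open>r\<close> on: a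
  minimal resolution has length at most \<open>n\<close>, so all binomial coefficients that occur are polynomial in
  this range. Hence \<open>J\<close> has dimension \<open>q\<close> in degree \<open>m\<close>, the same as \<open>vs (gin Y)\<close>.
\<close>

section \<open>Dimension of finite-dimensional subspaces\<close>

context vector_space
begin

text \<open>The ambient spaces of polynomials are infinite-dimensional. Enclosing a subspace in the
  span of a finite set \<open>B\<close> keeps its bases finite, so that \<open>card\<close> does not
  take its default value 0.\<close>

lemma finite_basis_exists:
  assumes "subspace U" "U \<subseteq> span B" "finite B"
  obtains C where "finite C" "C \<subseteq> U" "independent C" "span C = U" "card C = dim U"
proof -
  obtain C where C: "C \<subseteq> U" "independent C" "U \<subseteq> span C" "card C = dim U"
    by (rule basis_exists[of U])
  have "finite C"
    using independent_span_bound[OF assms(3) C(2) subset_trans[OF C(1) assms(2)]] ..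
  moreover have "span C = U"
    using span_minimal[OF C(1) assms(1)] C(3) by (rule subset_antisym)
  ultimately show thesis
    using that[OF _ C(1,2) _ C(4)] by iprover
qed

lemma card_independent_le_dim:
  assumes "independent C" "C \<subseteq> U" "U \<subseteq> span B" "finite B"
  shows "finite C \<and> card C \<le> dim U"
proof -
  obtain D where D: "D \<subseteq> U" "independent D" "U \<subseteq> span D" "card D = dim U"
    by (rule basis_exists[of U])
  have "finite D"
    using independent_span_bound[OF assms(4) D(2) subset_trans[OF D(1) assms(3)]] ..
  then show ?thesis
    using independent_span_bound[OF _ assms(1) subset_trans[OF assms(2) D(3)]] D(4) by simp
qed

end

context vector_space_pair
begin

text \<open>Rank-nullity for the restriction of \<open>f\<close> to \<open>U\<close>: a basis
  \<open>C\<close> of the kernel extends to a basis \<open>D\<close> of \<open>U\<close>, and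
  \<open>f\<close> maps \<open>D - C\<close> injectively onto a set that is independent and, up to
  0, spans the image.\<close>

lemma dim_kernel_plus_dim_image:
  assumes f: "Vector_Spaces.linear s1 s2 f" and U: "vs1.subspace U" and B: "U \<subseteq> vs1.span B" "finite B"
  shows "vs1.dim U = vs1.dim {x \<in> U. f x = 0} + vs2.dim (f ` U)"
proof -
  let ?K = "{x \<in> U. f x = 0}"
  have K: "vs1.subspace ?K"
    using vs1.subspace_inter[OF U linear_subspace_kernel[OF f]] by (simp add: Int_def)
  obtain C where C: "finite C" "C \<subseteq> ?K" "vs1.independent C" "vs1.span C = ?K" "card C = vs1.dim ?K"
    by (rule vs1.finite_basis_exists[OF K _ B(2)]) (use B(1) in auto)
  have "C \<subseteq> U" using C(2) by auto
  then obtain D where D: "C \<subseteq> D" "D \<subseteq> U" "vs1.independent D" "U \<subseteq> vs1.span D"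
    by (rule vs1.maximal_independent_subset_extend[OF _ C(3)])
  have finD: "finite D" using vs1.card_independent_le_dim[OF D(3,2) B] by blast
  have inj: "inj_on f (vs1.span (D - C))"
    unfolding linear_inj_on_iff_eq_0[OF f vs1.subspace_span]
  proof (intro ballI impI)
    fix x assume x: "x \<in> vs1.span (D - C)" "f x = 0"
    have "vs1.span (D - C) \<subseteq> U" using D(2) by (intro vs1.span_minimal U) auto
    then have xC: "x \<in> vs1.span C" using C(4) x by auto
    \<comment> \<open>Both agree with the representation over \<open>D\<close>, whose support then
      lies in \<open>D - C\<close> and in \<open>C\<close> and is therefore empty.\<close>
    have eq: "vs1.representation (D - C) x = vs1.representation C x"
      using vs1.representation_extend[OF D(3) x(1)] vs1.representation_extend[OF D(3) xC D(1)]
      by auto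
    then have "vs1.representation C x b = 0" for b
      using vs1.representation_ne_zero[of "D - C" x b] vs1.representation_ne_zero[of C x b]
      by auto
    then show "x = 0"
      using vs1.sum_nonzero_representation_eq[OF C(3) xC] by simp
  qed
  have "vs2.independent (f ` (D - C))"
    using linear_independent_injective_image[OF f _ inj] vs1.independent_mono[OF D(3)] by blast
  moreover have "f ` (D - C) \<subseteq> f ` U" using D by blast
  moreover have "f ` U \<subseteq> vs2.span (f ` (D - C))"
  proof -
    have "f ` U \<subseteq> vs2.span (f ` D)"
      using linear_spans_image[OF f D(4)] .
    also have "f ` D \<subseteq> insert 0 (f ` (D - C))" using C(2) by auto
    then have "vs2.span (f ` D) \<subseteq> vs2.span (insert 0 (f ` (D - C)))"
      by (rule vs2.span_mono)
    finally show ?thesis by simp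
  qed
  ultimately have "vs2.dim (f ` U) = card (f ` (D - C))"
    by (metis vs2.dim_unique)
  also have "\<dots> = card (D - C)"
    by (rule card_image) (rule inj_on_subset[OF inj vs1.span_superset])
  also have "\<dots> = card D - card C" using D(1) C(1) card_Diff_subset by blast
  also have "card D = vs1.dim U" using vs1.dim_unique[OF D(2,4,3)] by simp
  finally show ?thesis
    using C(5) card_mono[OF finD D(1)] \<open>card D = vs1.dim U\<close> by simp
qed

end

section \<open>Terms and polynomials\<close>

lemma lookup_smul [simp]: "Poly_Mapping.lookup (smul c f) t = c * Poly_Mapping.lookup f t"
  unfolding smul_def const_def mult_map_scale_conv_mult[symmetric]
  by (simp add: Poly_Mapping.map.rep_eq when_def)

lemma keys_smul: "Poly_Mapping.keys (smul c f) \<subseteq> Poly_Mapping.keys f"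
  by (auto simp: in_keys_iff)

lemma lookup_mon: "Poly_Mapping.lookup (mon s) t = (if s = t then 1 else 0)"
  by (simp add: mon_def lookup_single when_def)

lemma keys_mon [simp]: "Poly_Mapping.keys (mon t :: 'a::field mpol) = {t}"
  by (simp add: mon_def)

lemma inj_mon: "inj (mon :: trm \<Rightarrow> 'a::field mpol)"
  by (rule injI) (metis keys_mon singleton_inject)

lemma subspace_keys: "mp.subspace {f :: 'a::field mpol. Poly_Mapping.keys f \<subseteq> A}"
  by (rule mp.subspaceI) (auto dest!: subsetD[OF Poly_Mapping.keys_add] subsetD[OF keys_smul])

lemma poly_mapping_sum_mon:
  assumes "finite X" "Poly_Mapping.keys f \<subseteq> X"
  shows "f = (\<Sum>t\<in>X. smul (Poly_Mapping.lookup f t) (mon t))"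
proof (rule poly_mapping_eqI)
  fix s
  have "(\<Sum>t\<in>X. Poly_Mapping.lookup f t * (if t = s then 1 else 0)) = Poly_Mapping.lookup f s"
    using assms by (auto simp: if_distrib in_keys_iff cong: if_cong)
  then show "Poly_Mapping.lookup f s =
      Poly_Mapping.lookup (\<Sum>t\<in>X. smul (Poly_Mapping.lookup f t) (mon t)) s"
    by (simp add: lookup_sum lookup_mon)
qed

lemma span_mon: "mp.span (mon ` A) = {f :: 'a::field mpol. Poly_Mapping.keys f \<subseteq> A}"
proof (rule mp.span_subspace)
  show "{f :: 'a mpol. Poly_Mapping.keys f \<subseteq> A} \<subseteq> mp.span (mon ` A)"
  proof
    fix f :: "'a mpol" assume f: "f \<in> {f. Poly_Mapping.keys f \<subseteq> A}"
    have "(\<Sum>t\<in>Poly_Mapping.keys f. smul (Poly_Mapping.lookup f t) (mon t)) \<in> mp.span (mon ` A)"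
      using f by (intro mp.span_sum mp.span_scale mp.span_base imageI) auto
    then show "f \<in> mp.span (mon ` A)"
      using poly_mapping_sum_mon[of "Poly_Mapping.keys f" f] by simp
  qed
qed (auto simp: subspace_keys)

lemma independent_mon: "mp.independent (mon ` A :: 'a::field mpol set)"
  unfolding mp.dependent_def
proof safe
  fix t assume "(mon t :: 'a mpol) \<in> mp.span (mon ` A - {mon t})"
  also have "mon ` A - {mon t} = (mon ` (A - {t}) :: 'a mpol set)"
    using inj_mon by (auto dest: injD)
  finally have "(mon t :: 'a mpol) \<in> {f. Poly_Mapping.keys f \<subseteq> A - {t}}"
    unfolding span_mon .
  then show False by simp
qed

lemma dim_keys_subset:
  "mp.dim {f :: 'a::field mpol. Poly_Mapping.keys f \<subseteq> A} = card A"
proof -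
  have "card (mon ` A :: 'a mpol set) = card A"
    using card_image[OF inj_on_subset[OF inj_mon subset_UNIV]] .
  moreover have "mp.dim (mp.span (mon ` A :: 'a mpol set)) = card (mon ` A :: 'a mpol set)"
    by (rule mp.dim_span_eq_card_independent[OF independent_mon])
  ultimately show ?thesis by (simp only: span_mon)
qed

text \<open>Projection onto the span of the terms satisfying \<open>P\<close>. One operator serves
  for homogeneous components, for reading off finitely many coefficients and for setting variables
  to zero.\<close>

definition restr :: "('b \<Rightarrow> bool) \<Rightarrow> ('b \<Rightarrow>\<^sub>0 'c::comm_monoid_add) \<Rightarrow> 'b \<Rightarrow>\<^sub>0 'c" where
  "restr P f = (\<Sum>t\<in>{t \<in> Poly_Mapping.keys f. P t}. Poly_Mapping.single t (Poly_Mapping.lookup f t))"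

lemma lookup_restr [simp]:
  "Poly_Mapping.lookup (restr P f) t = (if P t then Poly_Mapping.lookup f t else 0)"
  by (auto simp: restr_def lookup_sum lookup_single when_def in_keys_iff)

lemma hom_comp_eq_restr: "hom_comp d = restr (\<lambda>t. tdeg t = d)"
  by (simp add: fun_eq_iff hom_comp_def restr_def)

lemma keys_restr [simp]: "Poly_Mapping.keys (restr P f) = {t \<in> Poly_Mapping.keys f. P t}"
  by (auto simp: in_keys_iff split: if_splits)

lemma restr_add: "restr P (f + g) = restr P f + restr P g"
  by (rule poly_mapping_eqI) (simp add: lookup_add)

lemma restr_zero [simp]: "restr P 0 = 0"
  by (rule poly_mapping_eqI) simp

lemma restr_sum: "restr P (sum f A) = (\<Sum>x\<in>A. restr P (f x))"
  by (rule poly_mapping_eqI) (simp add: lookup_sum)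

lemma restr_restr [simp]: "restr P (restr Q f) = restr (\<lambda>t. P t \<and> Q t) f"
  by (rule poly_mapping_eqI) simp

lemma restr_id: "(\<And>t. t \<in> Poly_Mapping.keys f \<Longrightarrow> P t) \<Longrightarrow> restr P f = f"
  by (rule poly_mapping_eqI) (auto simp: in_keys_iff)

lemma restr_eq_0: "(\<And>t. t \<in> Poly_Mapping.keys f \<Longrightarrow> \<not> P t) \<Longrightarrow> restr P f = 0"
  by (rule poly_mapping_eqI) (auto simp: in_keys_iff)

lemma restr_add_compl: "restr P f + restr (\<lambda>t. \<not> P t) f = f"
  by (rule poly_mapping_eqI) (simp add: lookup_add)

text \<open>Splitting \<open>g\<close> along \<open>Q\<close> splits the product into a part all of
  whose terms satisfy \<open>P\<close> and a part none of whose terms does.\<close>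

lemma restr_mult:
  fixes f g :: "'a::field mpol"
  assumes "\<And>s t. s \<in> Poly_Mapping.keys f \<Longrightarrow> t \<in> Poly_Mapping.keys g \<Longrightarrow> P (s + t) \<longleftrightarrow> Q t"
  shows "restr P (f * g) = f * restr Q g"
proof -
  have *: "f * g = f * restr Q g + f * restr (\<lambda>t. \<not> Q t) g"
    by (simp add: restr_add_compl flip: distrib_left)
  have "restr P (f * restr Q g) = f * restr Q g"
    using keys_mult[of f "restr Q g"] assms by (intro restr_id) fastforce
  moreover have "restr P (f * restr (\<lambda>t. \<not> Q t) g) = 0"
    using keys_mult[of f "restr (\<lambda>t. \<not> Q t) g"] assms by (intro restr_eq_0) fastforce
  ultimately show ?thesis by (simp add: * restr_add)
qed

section \<open>Degrees, and the number of terms of a given degree\<close>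

lemma tdeg_eq_sum: "finite X \<Longrightarrow> Poly_Mapping.keys t \<subseteq> X \<Longrightarrow> tdeg t = (\<Sum>v\<in>X. Poly_Mapping.lookup t v)"
  unfolding tdeg_def by (rule sum.mono_neutral_left) (auto simp: in_keys_iff)

lemma tdeg_add: "tdeg (s + t) = tdeg s + tdeg t"
  unfolding tdeg_def by (rule setsum_keys_plus_distrib) auto

lemma tdeg_zero [simp]: "tdeg 0 = 0"
  by (simp add: tdeg_def)

lemma tdeg_single [simp]: "tdeg (Poly_Mapping.single i d) = d"
  by (simp add: tdeg_def)

lemma keys_add_nat: "Poly_Mapping.keys (s + t :: trm) = Poly_Mapping.keys s \<union> Poly_Mapping.keys t"
  by (auto simp: in_keys_iff lookup_add)

lemma trms_add: "s + t \<in> trms n \<longleftrightarrow> s \<in> trms n \<and> t \<in> trms n"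
  by (auto simp: trms_def keys_add_nat)

lemma zero_in_trms [simp]: "0 \<in> trms n"
  by (simp add: trms_def)

text \<open>Passing to exponent lists reduces the count of terms to stars and bars, that is, to
  \<open>card_length_sum_list\<close>.\<close>

lemma bij_betw_trms_deg_lists:
  "bij_betw (\<lambda>t. map (Poly_Mapping.lookup t) [0..<Suc n]) (trms_deg n m)
     {l. length l = Suc n \<and> sum_list l = m}"
proof (rule bij_betwI[where g = Poly_Mapping.nth])
  show "(\<lambda>t. map (Poly_Mapping.lookup t) [0..<Suc n]) \<in> trms_deg n m \<rightarrow> {l. length l = Suc n \<and> sum_list l = m}"
    by (auto simp: trms_deg_def trms_def tdeg_eq_sum[of "{..n}"] interv_sum_list_conv_sum_set_nat
        atLeast0LessThan lessThan_Suc_atMost simp del: upt_Suc)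
  show "Poly_Mapping.nth \<in> {l. length l = Suc n \<and> sum_list l = m} \<rightarrow> trms_deg n m"
  proof
    fix l :: "nat list" assume l: "l \<in> {l. length l = Suc n \<and> sum_list l = m}"
    have "Poly_Mapping.keys (Poly_Mapping.nth l) \<subseteq> {..n}"
      using l by (auto simp: in_keys_iff nth_default_def simp del: keys_nth split: if_splits)
    moreover have "sum_list l = (\<Sum>i\<in>{..n}. nth_default 0 l i)"
      using l by (auto simp: sum_list_sum_nth nth_default_def atLeast0LessThan lessThan_Suc_atMost
          simp del: sum.lessThan_Suc sum.op_ivl_Suc intro!: sum.cong)
    ultimately show "Poly_Mapping.nth l \<in> trms_deg n m"
      using l by (auto simp: trms_deg_def trms_def tdeg_eq_sum[of "{..n}"])
  qed
  show "Poly_Mapping.nth (map (Poly_Mapping.lookup t) [0..<Suc n]) = t" if "t \<in> trms_deg n m" for t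
    using that by (intro poly_mapping_eqI)
      (auto simp: nth_default_def trms_deg_def trms_def in_keys_iff simp del: upt_Suc)
  show "map (Poly_Mapping.lookup (Poly_Mapping.nth l)) [0..<Suc n] = l"
    if "l \<in> {l. length l = Suc n \<and> sum_list l = m}" for l
    using that by (intro nth_equalityI) (auto simp: nth_default_def simp del: upt_Suc)
qed

lemma card_trms_deg: "card (trms_deg n m) = (n + m) choose n"
proof -
  have "card (trms_deg n m) = (m + Suc n - 1) choose m"
    by (rule trans[OF bij_betw_same_card[OF bij_betw_trms_deg_lists] card_length_sum_list])
  also have "m + Suc n - 1 = n + m" by simp
  also have "(n + m) choose m = (n + m) choose n"
    using binomial_symmetric[of n "n + m"] by simp
  finally show ?thesis .
qed

lemma finite_trms_deg [simp]: "finite (trms_deg n m)"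
  \<comment> \<open>An infinite set would have \<open>card\<close> 0, whereas the binomial
    coefficient is positive.\<close>
  by (metis card_trms_deg card_ge_0_finite zero_less_binomial le_add1)

lemma polys_deg_eq_span: "polys_deg n m = mp.span (mon ` trms_deg n m)"
  by (simp add: polys_deg_def span_mon)

lemma dim_polys_deg: "mp.dim (polys_deg n m :: 'a::field mpol set) = (n + m) choose n"
  by (simp add: polys_deg_def dim_keys_subset card_trms_deg)

lemma subspace_polys_deg: "mp.subspace (polys_deg n m)"
  by (simp add: polys_deg_def subspace_keys)

lemma polys_deg_subset_polys: "polys_deg n m \<subseteq> polys n"
  by (auto simp: polys_deg_def polys_def trms_deg_def)

lemma polys_zero [simp]: "0 \<in> polys n"
  by (simp add: polys_def)

lemma polys_add: "f \<in> polys n \<Longrightarrow> g \<in> polys n \<Longrightarrow> f + g \<in> polys n"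
  using Poly_Mapping.keys_add[of f g] by (auto simp: polys_def)

lemma polys_mult: "f \<in> polys n \<Longrightarrow> g \<in> polys n \<Longrightarrow> f * g \<in> polys n"
  using keys_mult[of f g] by (fastforce simp: polys_def trms_add)

lemma polys_sum: "(\<And>x. x \<in> A \<Longrightarrow> f x \<in> polys n) \<Longrightarrow> sum f A \<in> polys n"
  by (induction A rule: infinite_finite_induct) (auto intro: polys_add)

lemma polys_const: "const c \<in> polys n"
  by (auto simp: polys_def const_def)

lemma polys_restr: "f \<in> polys n \<Longrightarrow> restr P f \<in> polys n"
  by (auto simp: polys_def)

lemma polys_mon: "t \<in> trms n \<Longrightarrow> mon t \<in> polys n"
  by (simp add: polys_def)

lemma mon_mult_mon: "mon s * mon t = (mon (s + t) :: 'a::field mpol)"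
  by (simp add: mon_def Poly_Mapping.mult_single)

lemma lookup_mon_mult: "Poly_Mapping.lookup (mon s * f :: 'a::field mpol) (s + t) = Poly_Mapping.lookup f t"
proof -
  have "mon s * f = mon s * restr (\<lambda>u. u = t) f + mon s * restr (\<lambda>u. u \<noteq> t) f"
    unfolding distrib_left[symmetric] restr_add_compl ..
  moreover have "restr (\<lambda>u. u = t) f = Poly_Mapping.single t (Poly_Mapping.lookup f t)"
    by (rule poly_mapping_eqI) (simp add: lookup_single when_def)
  moreover have "s + t \<notin> Poly_Mapping.keys (mon s * restr (\<lambda>u. u \<noteq> t) f)"
    using keys_mult[of "mon s" "restr (\<lambda>u. u \<noteq> t) f"] by auto
  ultimately show ?thesis
    by (simp add: lookup_add mon_def Poly_Mapping.mult_single in_keys_iff)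
qed

lemma keys_mon_mult: "Poly_Mapping.keys (mon s * f :: 'a::field mpol) = (+) s ` Poly_Mapping.keys f"
proof
  show "Poly_Mapping.keys (mon s * f) \<subseteq> (+) s ` Poly_Mapping.keys f"
    using keys_mult[of "mon s" f] by auto
  show "(+) s ` Poly_Mapping.keys f \<subseteq> Poly_Mapping.keys (mon s * f)"
  proof safe
    fix t assume "t \<in> Poly_Mapping.keys f"
    then show "s + t \<in> Poly_Mapping.keys (mon s * f)"
      by (simp only: in_keys_iff lookup_mon_mult not_False_eq_True)
  qed
qed

interpretation mpp: vector_space_pair
  "smul :: 'a::field \<Rightarrow> 'a mpol \<Rightarrow> 'a mpol" "smul :: 'a::field \<Rightarrow> 'a mpol \<Rightarrow> 'a mpol" ..

section \<open>Leading terms\<close>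

lemma dim_zero_space: "mp.dim ({0} :: 'a::field mpol set) = 0"
  using mp.dim_span_eq_card_independent[OF mp.independent_empty] by (simp only: mp.span_empty card.empty)

lemma linear_restr: "Vector_Spaces.linear smul smul (restr P :: 'a::field mpol \<Rightarrow> 'a mpol)"
proof (rule Vector_Spaces.linear_iff[THEN iffD2], intro conjI allI)
  show "restr P (x + y) = restr P x + restr P y" for x y :: "'a mpol" by (rule restr_add)
  show "restr P (smul c x) = smul c (restr P x)" for c and x :: "'a mpol"
    by (rule poly_mapping_eqI) simp
qed (rule mp.vector_space_axioms)+

text \<open>Reading off the coefficients at \<open>A\<close> is an injective linear map from
  \<open>V\<close> into the span of the terms in \<open>A\<close>.\<close>

lemma dim_le_card_separating:
  fixes V :: "'a::field mpol set"
  assumes V: "mp.subspace V" "\<And>f. f \<in> V \<Longrightarrow> Poly_Mapping.keys f \<subseteq> X" and X: "finite X"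
    and A: "finite A" "\<And>f. f \<in> V \<Longrightarrow> (\<And>t. t \<in> A \<Longrightarrow> Poly_Mapping.lookup f t = 0) \<Longrightarrow> f = 0"
  shows "mp.dim V \<le> card A"
proof -
  let ?r = "restr (\<lambda>t. t \<in> A) :: 'a mpol \<Rightarrow> 'a mpol"
  have "V \<subseteq> mp.span (mon ` X)" using V(2) by (auto simp: span_mon)
  then have "mp.dim V = mp.dim {f \<in> V. ?r f = 0} + mp.dim (?r ` V)"
    using X by (intro mpp.dim_kernel_plus_dim_image linear_restr V(1)) auto
  also have "{f \<in> V. ?r f = 0} = {0}"
  proof -
    have "f = 0" if "f \<in> V" "?r f = 0" for f
      using A(2)[OF that(1)] arg_cong[OF that(2), of "\<lambda>g. Poly_Mapping.lookup g t" for t]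
      by (metis lookup_restr lookup_zero)
    then show ?thesis using mp.subspace_0[OF V(1)] by auto
  qed
  also have "mp.dim (?r ` V) \<le> card (mon ` A :: 'a mpol set)"
    using A(1) by (intro mp.dim_le_card) (auto simp: span_mon)
  also have "\<dots> \<le> card A" using A(1) by (rule card_image_le)
  finally show ?thesis by (simp add: dim_zero_space)
qed

locale ordered_terms =
  fixes n :: nat and prec :: "trm \<Rightarrow> trm \<Rightarrow> bool"
  assumes order: "term_order n prec"
begin

lemma prec_irrefl: "t \<in> trms n \<Longrightarrow> \<not> prec t t"
  using order by (auto simp: term_order_def irreflp_on_def)

lemma prec_trans: "prec s t \<Longrightarrow> prec t u \<Longrightarrow> s \<in> trms n \<Longrightarrow> t \<in> trms n \<Longrightarrow> u \<in> trms n \<Longrightarrow> prec s u"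
  using order unfolding term_order_def transp_on_def by blast

lemma prec_total: "s \<in> trms n \<Longrightarrow> t \<in> trms n \<Longrightarrow> prec s t \<or> s = t \<or> prec t s"
  using order unfolding term_order_def totalp_on_def by blast

lemma prec_add: "prec s t \<Longrightarrow> s \<in> trms n \<Longrightarrow> t \<in> trms n \<Longrightarrow> u \<in> trms n \<Longrightarrow> prec (u + s) (u + t)"
  using order unfolding term_order_def by (metis add.commute)

lemma ex_greatest_term:
  assumes "finite A" "A \<noteq> {}" "A \<subseteq> trms n"
  obtains t where "t \<in> A" "\<And>s. s \<in> A \<Longrightarrow> s = t \<or> prec s t"
proof -
  note A = subsetD[OF assms(3)]
  have transp: "transp_on A prec"
    using prec_trans[OF _ _ A A A] by (blast intro: transp_onI)
  have totalp: "totalp_on A prec"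
    using prec_total[OF A A] by (blast intro: totalp_onI)
  obtain t where "t \<in> A" "\<forall>s\<in>A. s \<noteq> t \<longrightarrow> prec s t"
    using Finite_Set.bex_greatest_element[OF assms(1,2) transp totalp] ..
  then show thesis using that[of t] by blast
qed

text \<open>A relation rather than a function, because \<open>prec\<close> is known to be an order
  only on \<open>trms n\<close>: existence and uniqueness of the leading term are available for
  elements of \<open>polys n\<close>.\<close>

definition lead :: "trm \<Rightarrow> 'a::field mpol \<Rightarrow> bool" where
  "lead t f \<longleftrightarrow> t \<in> Poly_Mapping.keys f \<and> (\<forall>s\<in>Poly_Mapping.keys f. s = t \<or> prec s t)"

definition LT :: "'a::field mpol set \<Rightarrow> trm set" where
  "LT V = {t. \<exists>f\<in>V. lead t f}"

lemma lead_exists: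
  assumes "f \<in> polys n" "f \<noteq> 0"
  obtains t where "lead t f"
proof -
  have "Poly_Mapping.keys f \<noteq> {}" "Poly_Mapping.keys f \<subseteq> trms n"
    using assms by (auto simp: polys_def)
  then obtain t where "t \<in> Poly_Mapping.keys f" "\<And>s. s \<in> Poly_Mapping.keys f \<Longrightarrow> s = t \<or> prec s t"
    by (rule ex_greatest_term[OF finite_keys]) (rule that)
  then show thesis using that[of t] by (simp add: lead_def)
qed

lemma lead_unique: "lead s f \<Longrightarrow> lead t f \<Longrightarrow> f \<in> polys n \<Longrightarrow> s = t"
  using prec_trans[of s t s] prec_irrefl[of s] unfolding lead_def polys_def
  by (metis mem_Collect_eq subsetD)

lemma lead_mon_mult:
  assumes "lead t f" "f \<in> polys n" "s \<in> trms n"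
  shows "lead (s + t) (mon s * f)"
  using assms by (auto simp: lead_def polys_def keys_mon_mult intro!: prec_add)

lemma LT_subset: "V \<subseteq> polys_deg n m \<Longrightarrow> LT V \<subseteq> trms_deg n m"
  by (auto simp: LT_def lead_def polys_deg_def)

text \<open>Echelon form without elimination: the coefficients at \<open>LT V\<close> separate the
  elements of \<open>V\<close>, which bounds the dimension from above; elements with pairwise
  different leading terms are independent, which bounds it from below.\<close>

lemma card_LT:
  fixes V :: "'a::field mpol set"
  assumes V: "mp.subspace V" "V \<subseteq> polys_deg n m"
  shows "card (LT V) = mp.dim V"
proof (rule antisym)
  have fin: "finite (LT V)" using LT_subset[OF V(2)] finite_subset finite_trms_deg by blast
  have polys: "f \<in> polys n" if "f \<in> V" for f using that V(2) polys_deg_subset_polys by blast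
  show "mp.dim V \<le> card (LT V)"
  proof (rule dim_le_card_separating[OF V(1) _ _ fin])
    show "Poly_Mapping.keys f \<subseteq> trms_deg n m" if "f \<in> V" for f
      using that V(2) by (auto simp: polys_deg_def)
    show "f = 0" if f: "f \<in> V" "\<And>t. t \<in> LT V \<Longrightarrow> Poly_Mapping.lookup f t = 0" for f
    proof (rule ccontr)
      assume "f \<noteq> 0"
      then obtain t where "lead t f" by (rule lead_exists[OF polys[OF f(1)]])
      then show False using f by (auto simp: LT_def lead_def in_keys_iff)
    qed
  qed simp
  have "\<forall>t\<in>LT V. \<exists>f. f \<in> V \<and> lead t f" by (auto simp: LT_def)
  then obtain h where h: "\<And>t. t \<in> LT V \<Longrightarrow> h t \<in> V \<and> lead t (h t)"
    by (metis bchoice)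
  have inj: "inj_on h (LT V)"
    by (rule inj_onI) (metis h lead_unique polys)
  have "mp.independent (h ` LT V)"
  proof (rule mp.independent_if_scalars_zero)
    fix c x assume sum: "(\<Sum>x\<in>h ` LT V. smul (c x) x) = 0" and x: "x \<in> h ` LT V"
    show "c x = 0"
    proof (rule ccontr)
      assume "c x \<noteq> 0"
      \<comment> \<open>The greatest leading term with nonzero coefficient cannot cancel, since it
        does not occur in elements with a smaller leading term.\<close>
      let ?S = "{t \<in> LT V. c (h t) \<noteq> 0}"
      have trms: "LT V \<subseteq> trms n" using LT_subset[OF V(2)] by (auto simp: trms_deg_def)
      have "finite ?S" "?S \<noteq> {}" "?S \<subseteq> trms n" using x \<open>c x \<noteq> 0\<close> fin trms by auto
      then obtain t where t: "t \<in> ?S" "\<And>s. s \<in> ?S \<Longrightarrow> s = t \<or> prec s t"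
        by (rule ex_greatest_term) (rule that)
      have "0 = (\<Sum>s\<in>LT V. c (h s) * Poly_Mapping.lookup (h s) t)"
        using arg_cong[OF sum, of "\<lambda>f. Poly_Mapping.lookup f t"]
        by (simp add: sum.reindex[OF inj] lookup_sum)
      also have "\<dots> = (\<Sum>s\<in>{t}. c (h s) * Poly_Mapping.lookup (h s) t)"
      proof (rule sum.mono_neutral_right)
        show "\<forall>s\<in>LT V - {t}. c (h s) * Poly_Mapping.lookup (h s) t = 0"
        proof
          fix s assume s: "s \<in> LT V - {t}"
          show "c (h s) * Poly_Mapping.lookup (h s) t = 0"
          proof (cases "c (h s) = 0")
            case False
            then have st: "prec s t" using t(2)[of s] s by auto
            have "t \<notin> Poly_Mapping.keys (h s)"
            proof
              assume "t \<in> Poly_Mapping.keys (h s)"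
              then have "prec t s" using h[of s] s by (auto simp: lead_def)
              then show False
                using st prec_trans[of s t s] prec_irrefl[of s] s t(1) trms by blast
            qed
            then show ?thesis by (simp add: in_keys_iff)
          qed simp
        qed
      qed (use fin t(1) in auto)
      finally show False using t(1) h[of t] by (auto simp: lead_def in_keys_iff)
    qed
  qed (use fin in simp)
  moreover have "h ` LT V \<subseteq> V" using h by blast
  moreover have "V \<subseteq> mp.span (mon ` trms_deg n m)" using V(2) by (simp add: polys_deg_eq_span)
  ultimately have "card (h ` LT V) \<le> mp.dim V"
    using mp.card_independent_le_dim[of "h ` LT V" V "mon ` trms_deg n m"] by simp
  then show "card (LT V) \<le> mp.dim V" by (simp add: card_image inj)
qed

end

section \<open>Pluecker coordinates\<close>

text \<open>The minor is the determinant of the map from coordinates over the chosen basis to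
  coefficients at \<open>L\<close>, so it is nonzero iff these coefficients separate
  \<open>V\<close>. The criterion no longer mentions the basis picked by
  \<open>SOME\<close>.\<close>

lemma plucker_ne_0_iff:
  fixes V :: "'a::field mpol set"
  assumes V: "V \<in> grass n m q" and L: "L \<in> ext_trms prec n m q"
  shows "plucker prec n m q V L \<noteq> 0 \<longleftrightarrow>
    (\<forall>f\<in>V. (\<forall>t\<in>set L. Poly_Mapping.lookup f t = 0) \<longrightarrow> f = 0)"
proof -
  have subV: "mp.subspace V" "V \<subseteq> mp.span (mon ` trms_deg n m)" "mp.dim V = q"
    using V by (auto simp: grass_def polys_deg_eq_span)
  let ?P = "\<lambda>fs. distinct fs \<and> mp.independent (set fs) \<and> mp.span (set fs) = V"
  define fs where "fs = (SOME fs. ?P fs)"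
  obtain C where C: "finite C" "mp.independent C" "mp.span C = V"
    by (rule mp.finite_basis_exists[OF subV(1,2)]) simp_all
  then have "\<exists>fs. ?P fs" using finite_distinct_list[OF C(1)] by metis
  then have "?P fs" unfolding fs_def by (rule someI_ex)
  then have fs: "distinct fs" "mp.independent (set fs)" "mp.span (set fs) = V" by auto
  have len: "length fs = q"
    using mp.dim_span_eq_card_independent[OF fs(2)] fs subV(3) distinct_card[OF fs(1)] by simp
  have lenL: "length L = q" using L by (simp add: ext_trms_def)
  \<comment> \<open>Row i holds coefficients of the i-th basis element, so it is the transpose of
    \<open>A\<close> that acts on the coordinate vector \<open>v\<close> of
    \<open>F v\<close>.\<close>
  define A where "A = mat q q (\<lambda>(i, j). Poly_Mapping.lookup (fs ! i) (L ! j))"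
  define F where "F v = (\<Sum>i<q. smul (v $ i) (fs ! i))" for v
  have A: "A\<^sup>T \<in> carrier_mat q q" by (simp add: A_def)
  have pl: "plucker prec n m q V L = det A\<^sup>T"
    using L det_transpose[of A q] by (simp add: plucker_def wedge_def fs_def[symmetric] A_def)
  have lookF: "Poly_Mapping.lookup (F v) (L ! j) = (A\<^sup>T *\<^sub>v v) $ j" if "v \<in> carrier_vec q" "j < q" for v j
    using that by (simp add: F_def lookup_sum A_def scalar_prod_def atLeast0LessThan mult.commute)
  have reindex: "(\<Sum>x\<in>set fs. g x) = (\<Sum>i<q. g (fs ! i))" for g :: "'a mpol \<Rightarrow> 'a mpol"
    using sum.reindex_bij_betw[OF bij_betw_nth[OF fs(1)], of "{..<q}" "set fs" g] len by simp
  have F_eq_0: "v = 0\<^sub>v q" if v: "v \<in> carrier_vec q" "F v = 0" for v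
  proof (rule eq_vecI)
    define c where "c x = v $ (the_inv_into {..<q} ((!) fs) x)" for x
    have inj: "inj_on ((!) fs) {..<q}" using fs(1) len by (simp add: inj_on_nth)
    have c: "c (fs ! i) = v $ i" if "i < q" for i
      using that the_inv_into_f_f[OF inj] by (simp add: c_def)
    have "(\<Sum>x\<in>set fs. smul (c x) x) = 0"
      using v(2) by (simp add: reindex c F_def)
    then have "c (fs ! i) = 0" if "i < q" for i
      using mp.independentD[OF fs(2) _ subset_refl] that len by simp
    then show "v $ i = 0\<^sub>v q $ i" if "i < dim_vec (0\<^sub>v q)" for i
      using c that by simp
  qed (use v(1) in simp)
  have F_V: "F v \<in> V" for v
    unfolding F_def using subV(1) fs(3) len
    by (intro mp.subspace_sum mp.subspace_scale) (auto intro: mp.span_base)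
  have F_surj: "\<exists>v\<in>carrier_vec q. F v = f" if f: "f \<in> V" for f
  proof -
    from f obtain u where "f = (\<Sum>x\<in>set fs. smul (u x) x)"
      unfolding fs(3)[symmetric] mp.span_finite[OF finite_set] by blast
    then have "F (vec q (\<lambda>i. u (fs ! i))) = f" by (simp add: F_def reindex)
    then show ?thesis by (intro bexI[of _ "vec q (\<lambda>i. u (fs ! i))"]) auto
  qed
  have vanish: "(\<forall>t\<in>set L. Poly_Mapping.lookup (F v) t = 0) \<longleftrightarrow> A\<^sup>T *\<^sub>v v = 0\<^sub>v q"
    if "v \<in> carrier_vec q" for v
  proof -
    have "(\<forall>t\<in>set L. Poly_Mapping.lookup (F v) t = 0) \<longleftrightarrow> (\<forall>j<q. (A\<^sup>T *\<^sub>v v) $ j = 0)"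
      using lookF[OF that] lenL by (auto simp: all_set_conv_all_nth)
    also have "\<dots> \<longleftrightarrow> A\<^sup>T *\<^sub>v v = 0\<^sub>v q"
    proof
      assume "\<forall>j<q. (A\<^sup>T *\<^sub>v v) $ j = 0"
      then show "A\<^sup>T *\<^sub>v v = 0\<^sub>v q" using A by (intro eq_vecI) auto
    qed simp
    finally show ?thesis .
  qed
  have F0: "F (0\<^sub>v q) = 0" by (simp add: F_def)
  have "det A\<^sup>T = 0 \<longleftrightarrow> (\<exists>f\<in>V. (\<forall>t\<in>set L. Poly_Mapping.lookup f t = 0) \<and> f \<noteq> 0)"
    unfolding det_0_iff_vec_prod_zero_field[OF A]
  proof
    assume "\<exists>v. v \<in> carrier_vec q \<and> v \<noteq> 0\<^sub>v q \<and> A\<^sup>T *\<^sub>v v = 0\<^sub>v q"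
    then obtain v where "v \<in> carrier_vec q" "v \<noteq> 0\<^sub>v q" "A\<^sup>T *\<^sub>v v = 0\<^sub>v q" by auto
    then show "\<exists>f\<in>V. (\<forall>t\<in>set L. Poly_Mapping.lookup f t = 0) \<and> f \<noteq> 0"
      using vanish F_eq_0 F_V by (intro bexI[of _ "F v"]) auto
  next
    assume "\<exists>f\<in>V. (\<forall>t\<in>set L. Poly_Mapping.lookup f t = 0) \<and> f \<noteq> 0"
    then obtain v where "v \<in> carrier_vec q" "\<forall>t\<in>set L. Poly_Mapping.lookup (F v) t = 0" "F v \<noteq> 0"
      using F_surj by metis
    then show "\<exists>v. v \<in> carrier_vec q \<and> v \<noteq> 0\<^sub>v q \<and> A\<^sup>T *\<^sub>v v = 0\<^sub>v q"
      using vanish F0 by auto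
  qed
  then show ?thesis unfolding pl by auto
qed

context ordered_terms
begin

lemma ext_trms_distinct:
  assumes "L \<in> ext_trms prec n m q"
  shows "distinct L"
proof -
  have "sorted_wrt (\<lambda>s t. prec t s) L" "set L \<subseteq> trms n"
    using assms by (auto simp: ext_trms_def trms_deg_def)
  then show ?thesis
    by (induction L) (auto dest: prec_irrefl)
qed

lemma ext_trms_nth_prec:
  assumes "L \<in> ext_trms prec n m q" "i < j" "j < q"
  shows "prec (L ! j) (L ! i)"
  using assms sorted_wrt_nth_less[of "\<lambda>s t. prec t s" L i j] by (auto simp: ext_trms_def)

lemma ext_trms_nth_trms:
  assumes "L \<in> ext_trms prec n m q" "i < q"
  shows "L ! i \<in> trms n"
  using assms subsetD[OF _ nth_mem, of L _ i] by (auto simp: ext_trms_def trms_deg_def)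

lemma ext_trms_exists:
  assumes "finite A" "A \<subseteq> trms_deg n m"
  obtains L where "L \<in> ext_trms prec n m (card A)" "set L = A"
proof -
  have "\<exists>L. L \<in> ext_trms prec n m (card A) \<and> set L = A"
    using assms
  proof (induction "card A" arbitrary: A)
    case 0
    then show ?case by (auto simp: ext_trms_def)
  next
    case (Suc k)
    have "A \<noteq> {}" "A \<subseteq> trms n" using Suc by (auto simp: trms_deg_def)
    then obtain t where t: "t \<in> A" "\<And>s. s \<in> A \<Longrightarrow> s = t \<or> prec s t"
      by (rule ex_greatest_term[OF Suc.prems(1)]) (rule that)
    have k: "card (A - {t}) = k" using Suc t by simp
    obtain L where L: "L \<in> ext_trms prec n m k" "set L = A - {t}"
      using Suc.hyps(1)[of "A - {t}"] Suc.prems k by auto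
    then have "t # L \<in> ext_trms prec n m (card A)" "set (t # L) = A"
      using t Suc by (auto simp: ext_trms_def)
    then show ?case by blast
  qed
  then show thesis using that by blast
qed

text \<open>A nonzero element of \<open>V\<close> has its own leading term in \<open>LT V\<close>,
  with nonzero coefficient.\<close>

lemma plucker_LT_ne_0:
  fixes V :: "'a::field mpol set"
  assumes V: "V \<in> grass n m q" and L: "L \<in> ext_trms prec n m q" "set L = LT V"
  shows "plucker prec n m q V L \<noteq> 0"
  unfolding plucker_ne_0_iff[OF V L(1)] L(2)
proof (intro ballI impI, rule ccontr)
  fix f assume f: "f \<in> V" "\<forall>t\<in>LT V. Poly_Mapping.lookup f t = 0" "f \<noteq> 0"
  have "f \<in> polys n" using f(1) V polys_deg_subset_polys by (auto simp: grass_def)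
  then obtain t where "lead t f" by (rule lead_exists[OF _ f(3)])
  then show False using f(1,2) by (auto simp: LT_def lead_def in_keys_iff)
qed

text \<open>
  The elements of \<open>V\<close> whose leading term lies outside the up-set \<open>U\<close> form a subspace, on which
  the coefficients at \<open>set L - U\<close> still separate points.
\<close>

lemma card_Int_upset_le:
  fixes V :: "'a::field mpol set"
  assumes V: "V \<in> grass n m q" and L: "L \<in> ext_trms prec n m q" "plucker prec n m q V L \<noteq> 0"
    and U: "\<And>s t. s \<in> U \<Longrightarrow> prec s t \<Longrightarrow> s \<in> trms n \<Longrightarrow> t \<in> trms n \<Longrightarrow> t \<in> U"
  shows "card (set L \<inter> U) \<le> card (LT V \<inter> U)"
proof -
  have V': "mp.subspace V" "V \<subseteq> polys_deg n m" "mp.dim V = q" using V by (auto simp: grass_def)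
  define W where "W = {f \<in> V. \<forall>t\<in>U. Poly_Mapping.lookup f t = 0}"
  have W: "mp.subspace W" "W \<subseteq> polys_deg n m"
    using V'(1,2) unfolding W_def
    by (auto intro!: mp.subspaceI simp: lookup_add mp.subspace_0 mp.subspace_add mp.subspace_scale)
  have fin: "finite (LT V)" using LT_subset[OF V'(2)] finite_subset finite_trms_deg by blast
  have "LT W = LT V - U"
  proof (intro equalityI subsetI)
    show "t \<in> LT V - U" if "t \<in> LT W" for t
      using that by (auto simp: LT_def W_def lead_def in_keys_iff)
    show "t \<in> LT W" if t: "t \<in> LT V - U" for t
    proof -
      obtain f where f: "f \<in> V" "lead t f" using t by (auto simp: LT_def)
      have sub: "Poly_Mapping.keys f \<subseteq> trms n" using f(1) V'(2) by (auto simp: polys_deg_def trms_deg_def)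
      have "s \<notin> Poly_Mapping.keys f" if s: "s \<in> U" for s
      proof
        assume "s \<in> Poly_Mapping.keys f"
        then have "s = t \<or> prec s t" "s \<in> trms n" "t \<in> trms n"
          using f(2) sub by (auto simp: lead_def)
        then have "t \<in> U" using U[OF s] s by auto
        then show False using t by simp
      qed
      then have "f \<in> W" using f(1) by (auto simp: W_def in_keys_iff)
      then show ?thesis using f(2) by (auto simp: LT_def)
    qed
  qed
  then have "card (LT V - U) = mp.dim W" using card_LT[OF W] by simp
  also have "\<dots> \<le> card (set L - U)"
  proof (rule dim_le_card_separating[OF W(1) _ finite_trms_deg])
    show "Poly_Mapping.keys f \<subseteq> trms_deg n m" if "f \<in> W" for f
      using that W(2) by (auto simp: polys_deg_def)
    show "f = 0" if f: "f \<in> W" "\<And>t. t \<in> set L - U \<Longrightarrow> Poly_Mapping.lookup f t = 0" for f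
    proof -
      have "\<forall>t\<in>set L. Poly_Mapping.lookup f t = 0" "f \<in> V" using f by (auto simp: W_def)
      then show ?thesis using L(2) unfolding plucker_ne_0_iff[OF V L(1)] by blast
    qed
  qed simp
  finally have "card (LT V - U) \<le> card (set L - U)" .
  \<comment> \<open>Both \<open>set L\<close> and \<open>LT V\<close> have q elements, so the
    inequality outside \<open>U\<close> reverses inside \<open>U\<close>.\<close>
  moreover have "card (set L) = q"
    using L(1) distinct_card[OF ext_trms_distinct[OF L(1)]] by (simp add: ext_trms_def)
  moreover have "card (LT V) = q" using card_LT[OF V'(1,2)] V'(3) by simp
  ultimately show ?thesis
    using card_Int_Diff[OF fin, of U] card_Int_Diff[of "set L" U] by simp
qed

text \<open>If \<open>M ! i\<close> were smaller than \<open>L ! i\<close>, the up-set of terms from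
  \<open>L ! i\<close> on would contain at least i + 1 entries of \<open>L\<close> but at most i
  entries of \<open>M\<close>, against \<open>card_Int_upset_le\<close>.\<close>

lemma plucker_ne_0_nth_le_LT:
  fixes V :: "'a::field mpol set"
  assumes V: "V \<in> grass n m q" and L: "L \<in> ext_trms prec n m q" "plucker prec n m q V L \<noteq> 0"
    and M: "M \<in> ext_trms prec n m q" "set M = LT V" and i: "i < q"
  shows "prec (L ! i) (M ! i) \<or> L ! i = M ! i"
proof (rule ccontr)
  assume contr: "\<not> ?thesis"
  note Lt = ext_trms_nth_trms[OF L(1)] and Mt = ext_trms_nth_trms[OF M(1)]
  have less: "prec (M ! i) (L ! i)" using contr prec_total[OF Lt[OF i] Mt[OF i]] by blast
  define U where "U = {t \<in> trms n. t = L ! i \<or> prec (L ! i) t}"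
  have lenL: "length L = q" and lenM: "length M = q" using L(1) M(1) by (auto simp: ext_trms_def)
  have "card (set L \<inter> U) \<le> card (LT V \<inter> U)"
  proof (rule card_Int_upset_le[OF V L])
    show "t \<in> U" if "s \<in> U" "prec s t" "s \<in> trms n" "t \<in> trms n" for s t
      using that prec_trans[of "L ! i" s t] Lt[OF i] by (auto simp: U_def)
  qed
  moreover have "Suc i \<le> card (set L \<inter> U)"
  proof -
    have "L ! j \<in> set L \<inter> U" if "j \<le> i" for j
      using that i lenL Lt[of j] ext_trms_nth_prec[OF L(1), of j i] by (cases "j = i") (auto simp: U_def)
    then have "(!) L ` {..i} \<subseteq> set L \<inter> U" by blast
    moreover have "inj_on ((!) L) {..i}"
      using ext_trms_distinct[OF L(1)] i lenL by (intro inj_on_nth) auto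
    ultimately show ?thesis
      using card_mono[of "set L \<inter> U" "(!) L ` {..i}"] card_image[of "(!) L" "{..i}"] by simp
  qed
  moreover have "card (set M \<inter> U) \<le> i"
  proof -
    have "M ! j \<notin> U" if j: "i \<le> j" "j < q" for j
    proof
      assume "M ! j \<in> U"
      then have "M ! j = L ! i \<or> prec (L ! i) (M ! j)" by (auto simp: U_def)
      moreover have "M ! j = M ! i \<or> prec (M ! j) (M ! i)"
        using ext_trms_nth_prec[OF M(1), of i j] j by (cases "i = j") auto
      ultimately show False
        using less Lt[OF i] Mt[OF i] Mt[OF j(2)] prec_trans prec_irrefl by metis
    qed
    then have "set M \<inter> U \<subseteq> (!) M ` {..<i}"
      using lenM by (auto simp: in_set_conv_nth) (metis imageI lessThan_iff not_le)
    then have "card (set M \<inter> U) \<le> card ((!) M ` {..<i})" by (intro card_mono) auto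
    also have "\<dots> \<le> i" using card_image_le[of "{..<i}" "(!) M"] by simp
    finally show ?thesis .
  qed
  ultimately show False using M(2) by simp
qed

section \<open>Lexicographic order of exterior terms and the maximum defining
  \<open>gin\<close>\<close>

lemma finite_ext_trms: "finite (ext_trms prec n m q)"
  by (rule finite_subset[OF _ finite_lists_length_eq[OF finite_trms_deg, of n m q]])
    (auto simp: ext_trms_def)

lemma ext_less_not_ge:
  assumes "L \<in> ext_trms prec n m q" "M \<in> ext_trms prec n m q"
    and "\<And>i. i < q \<Longrightarrow> prec (L ! i) (M ! i) \<or> L ! i = M ! i"
  shows "\<not> ext_less prec M L"
proof
  assume "ext_less prec M L"
  then obtain j where j: "j < q" "prec (M ! j) (L ! j)"
    using assms by (auto simp: ext_less_def ext_trms_def)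
  then show False
    using assms(3)[of j] ext_trms_nth_trms[OF assms(1), of j] ext_trms_nth_trms[OF assms(2), of j]
      prec_trans prec_irrefl by metis
qed

lemma ext_less_linear:
  "transp_on (ext_trms prec n m q) (ext_less prec)"
  "asymp_on (ext_trms prec n m q) (ext_less prec)"
  "totalp_on (ext_trms prec n m q) (ext_less prec)"
proof -
  let ?T = "ext_trms prec n m q"
  have len: "length L = q" if "L \<in> ?T" for L using that by (simp add: ext_trms_def)
  note t = ext_trms_nth_trms[of _ m q]
  show transp: "transp_on ?T (ext_less prec)"
  proof (rule transp_onI)
    fix L M N assume T: "L \<in> ?T" "M \<in> ?T" "N \<in> ?T" and "ext_less prec L M" "ext_less prec M N"
    then obtain i j where i: "i < q" "\<forall>k<i. L ! k = M ! k" "prec (L ! i) (M ! i)"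
      and j: "j < q" "\<forall>k<j. M ! k = N ! k" "prec (M ! j) (N ! j)"
      by (auto simp: ext_less_def len)
    \<comment> \<open>Before the smaller of the two positions of first difference, all three lists
      agree.\<close>
    have "prec (L ! min i j) (N ! min i j)"
      using i j t[OF T(1)] t[OF T(2)] t[OF T(3)] prec_trans
      by (cases i j rule: linorder_cases) (auto simp: min_def)
    then show "ext_less prec L N"
      using i j T by (auto simp: ext_less_def len intro!: exI[of _ "min i j"])
  qed
  have "\<not> ext_less prec L L" if "L \<in> ?T" for L
    using that t[OF that] prec_irrefl by (auto simp: ext_less_def len)
  then show "asymp_on ?T (ext_less prec)"
    using transp_onD[OF transp] by (blast intro: asymp_onI)
  show "totalp_on ?T (ext_less prec)"
  proof (rule totalp_onI)
    fix L M assume T: "L \<in> ?T" "M \<in> ?T" and "L \<noteq> M"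
    then obtain i where "i < q \<and> L ! i \<noteq> M ! i"
      using nth_equalityI[of L M] len by auto
    then obtain j where j: "j < q \<and> L ! j \<noteq> M ! j" "\<And>k. k < j \<Longrightarrow> \<not> (k < q \<and> L ! k \<noteq> M ! k)"
      using exists_least_iff[of "\<lambda>i. i < q \<and> L ! i \<noteq> M ! i"] by blast
    then have "prec (L ! j) (M ! j) \<or> prec (M ! j) (L ! j)"
      using prec_total t T by blast
    then show "ext_less prec L M \<or> ext_less prec M L"
      using j T unfolding ext_less_def by (metis len order.strict_trans)
  qed
qed

text \<open>\<open>gin\<close> is defined by \<open>THE\<close>. The candidates form a finite
  linearly ordered set, so a single candidate is enough for the description to have exactly one
  solution.\<close>

lemma gin_greatest:
  fixes W :: "'a::field mpol set set" and emb :: "'k::field \<Rightarrow> 'a" and m q :: nat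
  defines "\<L> \<equiv> {L \<in> ext_trms prec n m q. U_open prec n m q L \<inter> orbits emb n W \<noteq> {}}"
  assumes "\<L> \<noteq> {}"
  shows "gin emb prec n m q W \<in> \<L>"
    and "L \<in> \<L> \<Longrightarrow> L = gin emb prec n m q W \<or> ext_less prec L (gin emb prec n m q W)"
proof -
  have sub: "\<L> \<subseteq> ext_trms prec n m q" by (auto simp: \<L>_def)
  note lin = transp_on_subset[OF ext_less_linear(1) sub] totalp_on_subset[OF ext_less_linear(3) sub]
    asymp_on_subset[OF ext_less_linear(2) sub]
  have "finite \<L>" using finite_subset[OF sub finite_ext_trms] .
  then obtain M where M: "M \<in> \<L>" "\<forall>L\<in>\<L>. L \<noteq> M \<longrightarrow> ext_less prec L M"
    using Finite_Set.bex_greatest_element[OF _ assms(2) lin(1,2)] by auto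
  have "\<exists>!M. M \<in> \<L> \<and> (\<forall>L\<in>\<L>. L = M \<or> ext_less prec L M)"
  proof (intro ex1I[of _ M] conjI)
    show "\<forall>L\<in>\<L>. L = M \<or> ext_less prec L M" using M(2) by auto
    show "N = M" if N: "N \<in> \<L> \<and> (\<forall>L\<in>\<L>. L = N \<or> ext_less prec L N)" for N
    proof (rule ccontr)
      assume "N \<noteq> M"
      then have "ext_less prec N M" "ext_less prec M N" using M N by auto
      then show False using asymp_onD[OF lin(3)] M(1) N by simp
    qed
  qed (rule M(1))
  from theI'[OF this] show "gin emb prec n m q W \<in> \<L>"
    "L \<in> \<L> \<Longrightarrow> L = gin emb prec n m q W \<or> ext_less prec L (gin emb prec n m q W)"
    unfolding gin_def \<L>_def[symmetric] Let_def by blast+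
qed

end

section \<open>Domination by the generic initial extensor\<close>

text \<open>Stated on \<open>polys n\<close>, because the entries of the matrix in rows beyond n are
  unspecified and nothing is known about the images of later variables.\<close>

lemma act_one:
  fixes f :: "'a::field mpol"
  assumes "f \<in> polys n"
  shows "act n (1\<^sub>m (n + 1)) f = f"
proof -
  have var: "(\<Sum>j\<le>n. const ((1\<^sub>m (n + 1) :: 'a mat) $$ (i, j)) * mon (var_trm j)) = mon (var_trm i)"
    if "i \<le> n" for i
  proof -
    have "const ((1\<^sub>m (n + 1) :: 'a mat) $$ (i, j)) * mon (var_trm j) =
        (if j = i then mon (var_trm i) else 0)" if "j \<le> n" for j
      using that \<open>i \<le> n\<close> by (auto simp: const_def)
    then show ?thesis using that by simp
  qed
  have power: "(mon (var_trm i) :: 'a mpol) ^ k = mon (Poly_Mapping.single i k)" for i k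
  proof (induction k)
    case (Suc k)
    then show ?case by (simp add: mon_mult_mon var_trm_def flip: Poly_Mapping.single_add)
  qed (simp add: mon_def)
  have prod: "(\<Prod>i\<in>X. mon (g i)) = (mon (\<Sum>i\<in>X. g i) :: 'a mpol)" for X :: "nat set" and g
    by (induction X rule: infinite_finite_induct) (simp_all add: mon_mult_mon, simp_all add: mon_def)
  have decomp: "(\<Sum>i\<in>Poly_Mapping.keys t. Poly_Mapping.single i (Poly_Mapping.lookup t i)) = t" for t :: trm
    by (rule poly_mapping_eqI) (auto simp: lookup_sum lookup_single when_def in_keys_iff)
  have "act n (1\<^sub>m (n + 1)) f =
      (\<Sum>t\<in>Poly_Mapping.keys f. const (Poly_Mapping.lookup f t) * mon t)"
    unfolding act_def
  proof (intro sum.cong refl arg_cong2[where f = "(*)"])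
    fix t assume "t \<in> Poly_Mapping.keys f"
    then have "Poly_Mapping.keys t \<subseteq> {..n}" using assms by (auto simp: polys_def trms_def)
    then have "(\<Prod>i\<in>Poly_Mapping.keys t.
        (\<Sum>j\<le>n. const ((1\<^sub>m (n + 1) :: 'a mat) $$ (i, j)) * mon (var_trm j)) ^ Poly_Mapping.lookup t i) =
        (\<Prod>i\<in>Poly_Mapping.keys t. mon (Poly_Mapping.single i (Poly_Mapping.lookup t i)))"
      by (intro prod.cong refl) (simp only: var power subset_iff atMost_iff)
    then show "(\<Prod>i\<in>Poly_Mapping.keys t.
        (\<Sum>j\<le>n. const ((1\<^sub>m (n + 1) :: 'a mat) $$ (i, j)) * mon (var_trm j)) ^ Poly_Mapping.lookup t i) = mon t"
      by (simp only: prod decomp)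
  qed
  also have "\<dots> = f"
    using poly_mapping_sum_mon[of "Poly_Mapping.keys f" f] by (simp add: smul_def)
  finally show ?thesis .
qed

lemma subset_orbits:
  fixes emb :: "'k::field \<Rightarrow> 'a::field"
  assumes emb: "field_hom emb" and W: "W \<subseteq> grass n m q"
  shows "W \<subseteq> orbits emb n W"
proof
  fix V assume V: "V \<in> W"
  interpret field_hom emb by (rule emb)
  have one: "map_mat emb (1\<^sub>m (n + 1)) = 1\<^sub>m (n + 1)"
    by (rule eq_matI) auto
  have "act n (1\<^sub>m (n + 1)) f = f" if "f \<in> V" for f
    using that V W by (intro act_one subsetD[OF polys_deg_subset_polys[of n m]]) (auto simp: grass_def)
  then have "act n (map_mat emb (1\<^sub>m (n + 1))) ` V = V"
    unfolding one by (simp only: image_cong image_ident)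
  moreover have "1\<^sub>m (n + 1) \<in> GL n"
    by (auto simp: GL_def invertible_mat_def inverts_mat_def intro!: exI[of _ "1\<^sub>m (n + 1)"])
  ultimately show "V \<in> orbits emb n W"
    unfolding orbits_def using V by (intro CollectI exI[of _ V] exI[of _ "1\<^sub>m (n + 1)"]) simp
qed

text \<open>The zero locus of a single linear form, the coordinate at \<open>L\<close>. It is the
  complement of \<open>U_open\<close>, so irreducibility can be applied to these open sets.\<close>

lemma zariski_closed_plucker_zero:
  fixes emb :: "'k::field \<Rightarrow> 'a::field"
  assumes emb: "field_hom emb" and L: "L \<in> ext_trms prec n m q"
  shows "zariski_closed emb prec n m q {V \<in> grass n m q. plucker prec n m q V L = 0}"
proof -
  interpret field_hom emb by (rule emb)
  let ?F = "Poly_Mapping.single (Poly_Mapping.single L 1) 1 :: (trm list \<Rightarrow>\<^sub>0 nat) \<Rightarrow>\<^sub>0 'k"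
  have "?F \<in> plucker_forms prec n m q"
    using L by (auto simp: plucker_forms_def)
  moreover have "eval_poly emb ?F x = x L" for x
    by (simp add: eval_poly_def)
  ultimately show ?thesis
    unfolding zariski_closed_def by (intro exI[of _ "{?F}"]) auto
qed

context ordered_terms
begin

lemma ex_LT_list:
  fixes V :: "'a::field mpol set"
  assumes "V \<in> grass n m q"
  obtains M where "M \<in> ext_trms prec n m q" "set M = LT V"
proof -
  have V: "mp.subspace V" "V \<subseteq> polys_deg n m" "mp.dim V = q" using assms by (auto simp: grass_def)
  show thesis
    using ext_trms_exists[OF finite_subset[OF LT_subset[OF V(2)] finite_trms_deg] LT_subset[OF V(2)]]
      card_LT[OF V(1,2)] V(3) that by metis
qed

lemma gin_dominates:
  fixes emb :: "'k::field \<Rightarrow> 'a::field" and Y :: "'a mpol set set"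
  assumes emb: "field_hom emb" and Y: "GL_stable emb prec n p m q Y"
  shows "gin emb prec n m q Y \<in> ext_trms prec n m q"
    and "\<exists>W\<in>Y. LT W = set (gin emb prec n m q Y)"
    and "V \<in> Y \<Longrightarrow> L \<in> ext_trms prec n m q \<Longrightarrow> plucker prec n m q V L \<noteq> 0 \<Longrightarrow> i < q \<Longrightarrow>
      prec (L ! i) (gin emb prec n m q Y ! i) \<or> L ! i = gin emb prec n m q Y ! i"
proof -
  let ?gin = "gin emb prec n m q Y"
  let ?\<L> = "{L \<in> ext_trms prec n m q. U_open prec n m q L \<inter> orbits emb n Y \<noteq> {}}"
  have grass: "Y \<subseteq> grass n m q" and ne: "Y \<noteq> {}"
    and irred: "\<And>C D. zariski_closed emb prec n m q C \<Longrightarrow> zariski_closed emb prec n m q D \<Longrightarrow>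
      Y \<subseteq> C \<union> D \<Longrightarrow> Y \<subseteq> C \<or> Y \<subseteq> D"
    using Y by (auto simp: GL_stable_def hilb_def zariski_irreducible_def)
  \<comment> \<open>By stability the orbit of \<open>Y\<close> is \<open>Y\<close>, so the
    candidates for \<open>gin\<close> are the exterior terms whose coordinate is nonzero somewhere
    on \<open>Y\<close>.\<close>
  have "orbits emb n Y \<subseteq> Y"
    using Y by (auto simp: orbits_def GL_stable_def)
  then have orbits: "orbits emb n Y = Y"
    using subset_orbits[OF emb grass] by (rule subset_antisym)
  have mem: "M \<in> ?\<L>" if "V \<in> Y" "M \<in> ext_trms prec n m q" "plucker prec n m q V M \<noteq> 0" for V M
    using that grass unfolding orbits by (auto simp: U_open_def)
  obtain V0 where V0: "V0 \<in> Y" using ne by blast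
  then obtain M0 where M0: "M0 \<in> ext_trms prec n m q" "set M0 = LT V0" using ex_LT_list grass by blast
  have "?\<L> \<noteq> {}" using mem[OF V0 M0(1)] plucker_LT_ne_0[OF _ M0] V0 grass by blast
  note gin = gin_greatest[OF this]
  show gT: "?gin \<in> ext_trms prec n m q" using gin(1) by simp
  \<comment> \<open>The leading list \<open>M\<close> of such a \<open>W\<close> lies above
    \<open>?gin\<close> componentwise, hence is not lexicographically smaller, and it is itself a
    candidate for the maximum.\<close>
  have LT_eq: "M = ?gin"
    if W: "W \<in> Y" "plucker prec n m q W ?gin \<noteq> 0" and M: "M \<in> ext_trms prec n m q" "set M = LT W"
    for W M
  proof -
    have Wg: "W \<in> grass n m q" using W grass by blast
    have "\<not> ext_less prec M ?gin"
      using plucker_ne_0_nth_le_LT[OF Wg gT W(2) M] by (intro ext_less_not_ge[OF gT M(1)])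
    moreover have "M \<in> ?\<L>" using mem[OF W(1) M(1) plucker_LT_ne_0[OF Wg M]] .
    ultimately show ?thesis using gin(2) by blast
  qed
  obtain W0 where W0: "W0 \<in> Y" "plucker prec n m q W0 ?gin \<noteq> 0"
    using gin(1) unfolding orbits by (auto simp: U_open_def)
  then obtain M1 where M1: "M1 \<in> ext_trms prec n m q" "set M1 = LT W0" using ex_LT_list grass by blast
  show "\<exists>W\<in>Y. LT W = set ?gin" using LT_eq[OF W0 M1] M1(2) W0(1) by auto
  assume V: "V \<in> Y" and L: "L \<in> ext_trms prec n m q" "plucker prec n m q V L \<noteq> 0" and i: "i < q"
  let ?Z = "\<lambda>L. {V \<in> grass n m q. plucker prec n m q V L = 0}"
  \<comment> \<open>Neither coordinate vanishes on all of the irreducible \<open>Y\<close>, so both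
    are nonzero at a common point.\<close>
  have "\<not> Y \<subseteq> ?Z L" "\<not> Y \<subseteq> ?Z ?gin" using V L(2) W0 by auto
  then have "\<not> Y \<subseteq> ?Z L \<union> ?Z ?gin"
    using irred[OF zariski_closed_plucker_zero[OF emb L(1)] zariski_closed_plucker_zero[OF emb gT]] by blast
  then obtain W where W: "W \<in> Y" "plucker prec n m q W L \<noteq> 0" "plucker prec n m q W ?gin \<noteq> 0"
    using grass by auto
  obtain M where M: "M \<in> ext_trms prec n m q" "set M = LT W" using ex_LT_list W(1) grass by blast
  show "prec (L ! i) (?gin ! i) \<or> L ! i = ?gin ! i"
    using plucker_ne_0_nth_le_LT[OF _ L(1) W(2) M i] LT_eq[OF W(1,3) M] W(1) grass by auto
qed

lemma dominatedI:
  assumes L: "L \<in> ext_trms prec n m q" and M: "M \<in> ext_trms prec n m q"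
    and le: "\<And>i. i < q \<Longrightarrow> prec (L ! i) (M ! i) \<or> L ! i = M ! i"
  shows "dominated prec n m q (vs L :: 'a::field mpol set) (vs M)"
proof -
  have L': "distinct L" "length L = q" "set L \<subseteq> trms_deg n m"
    and M': "distinct M" "length M = q" "set M \<subseteq> trms_deg n m"
    using L M ext_trms_distinct by (auto simp: ext_trms_def)
  \<comment> \<open>The required bijection matches the two decreasing lists position by
    position.\<close>
  define \<omega> where "\<omega> = (!) M \<circ> the_inv_into {..<q} ((!) L)"
  have bijL: "bij_betw ((!) L) {..<q} (set L)" and bijM: "bij_betw ((!) M) {..<q} (set M)"
    using L' M' by (auto intro!: bij_betw_nth)
  have \<omega>: "\<omega> (L ! i) = M ! i" if "i < q" for i
    using that the_inv_into_f_f[OF bij_betw_imp_inj_on[OF bijL]] by (simp add: \<omega>_def)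
  have "bij_betw \<omega> (set L) (set M)"
    unfolding \<omega>_def by (rule bij_betw_trans[OF bij_betw_the_inv_into[OF bijL] bijM])
  moreover have "prec a (\<omega> a) \<or> a = \<omega> a" if a: "a \<in> set L" for a
  proof -
    obtain i where "i < q" "a = L ! i" using a L'(2) by (auto simp: in_set_conv_nth)
    then show ?thesis using le[of i] \<omega>[of i] by simp
  qed
  ultimately show ?thesis
    unfolding dominated_def vs_def using L' M' distinct_card[OF L'(1)] distinct_card[OF M'(1)]
    by (intro exI[of _ "set L"] exI[of _ "set M"]) auto
qed

text \<open>Extending scalars keeps supports inside \<open>set L\<close>, so only 0 vanishes at all
  terms of \<open>L\<close>.\<close>

lemma plucker_extend_vs:
  fixes emb :: "'k::field \<Rightarrow> 'a::field"
  assumes emb: "field_hom emb" and L: "L \<in> ext_trms prec n m q"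
    and V: "extend_scalars emb (vs L) \<in> grass n m q"
  shows "plucker prec n m q (extend_scalars emb (vs L)) L \<noteq> 0"
proof -
  interpret field_hom emb by (rule emb)
  have "Poly_Mapping.map emb f \<in> {f. Poly_Mapping.keys f \<subseteq> set L}" if "f \<in> vs L" for f
    using that by (auto simp: vs_def span_mon in_keys_iff Poly_Mapping.map.rep_eq when_def
        split: if_splits)
  then have "extend_scalars emb (vs L) \<subseteq> {f. Poly_Mapping.keys f \<subseteq> set L}"
    unfolding extend_scalars_def by (intro mp.span_minimal subspace_keys) auto
  note sub = this
  show ?thesis
    unfolding plucker_ne_0_iff[OF V L]
  proof (intro ballI impI)
    fix f assume f: "f \<in> extend_scalars emb (vs L)" "\<forall>t\<in>set L. Poly_Mapping.lookup f t = 0"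
    show "f = 0"
    proof (rule poly_mapping_eqI)
      show "Poly_Mapping.lookup f t = Poly_Mapping.lookup 0 t" for t
        using f subsetD[OF sub f(1)] by (cases "t \<in> set L") (auto simp: in_keys_iff)
    qed
  qed
qed

end

section \<open>Graded complexes of free modules\<close>

text \<open>Elements of free modules are sequences of polynomials which vanish from the rank onwards.\<close>

definition fsmul :: "'a::field \<Rightarrow> (nat \<Rightarrow> 'a mpol) \<Rightarrow> nat \<Rightarrow> 'a mpol" where
  "fsmul c v j = smul c (v j)"

interpretation fv: vector_space "fsmul :: 'a::field \<Rightarrow> (nat \<Rightarrow> 'a mpol) \<Rightarrow> nat \<Rightarrow> 'a mpol"
  by unfold_locales
    (auto simp: fsmul_def fun_eq_iff mp.scale_right_distrib mp.scale_left_distrib)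

interpretation fvp: vector_space_pair
  "fsmul :: 'a::field \<Rightarrow> (nat \<Rightarrow> 'a mpol) \<Rightarrow> nat \<Rightarrow> 'a mpol"
  "fsmul :: 'a::field \<Rightarrow> (nat \<Rightarrow> 'a mpol) \<Rightarrow> nat \<Rightarrow> 'a mpol" ..

interpretation fvm: vector_space_pair
  "fsmul :: 'a::field \<Rightarrow> (nat \<Rightarrow> 'a mpol) \<Rightarrow> nat \<Rightarrow> 'a mpol"
  "smul :: 'a::field \<Rightarrow> 'a mpol \<Rightarrow> 'a mpol" ..

interpretation mfv: vector_space_pair
  "smul :: 'a::field \<Rightarrow> 'a mpol \<Rightarrow> 'a mpol"
  "fsmul :: 'a::field \<Rightarrow> (nat \<Rightarrow> 'a mpol) \<Rightarrow> nat \<Rightarrow> 'a mpol" ..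

definition at_index :: "nat \<Rightarrow> 'a::field mpol \<Rightarrow> nat \<Rightarrow> 'a mpol" where
  "at_index i f j = (if j = i then f else 0)"

lemma linear_at_index: "Vector_Spaces.linear smul fsmul (at_index i :: 'a::field mpol \<Rightarrow> _)"
  by (rule Vector_Spaces.linear_iff[THEN iffD2])
    (auto simp: at_index_def fsmul_def fun_eq_iff mp.vector_space_axioms fv.vector_space_axioms)

lemma linear_coord: "Vector_Spaces.linear fsmul smul (\<lambda>v. v i :: 'a::field mpol)"
  by (rule Vector_Spaces.linear_iff[THEN iffD2])
    (auto simp: fsmul_def mp.vector_space_axioms fv.vector_space_axioms)

text \<open>The term basis of \<open>S(-a)\<close> in degree t. The additive condition gives the
  empty set for t < a, where truncated subtraction would not.\<close>

definition shifted_trms :: "nat \<Rightarrow> nat \<Rightarrow> nat \<Rightarrow> trm set" where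
  "shifted_trms n a t = {s \<in> trms n. tdeg s + a = t}"

lemma shifted_trms_eq: "shifted_trms n a t = (if a \<le> t then trms_deg n (t - a) else {})"
  by (auto simp: shifted_trms_def trms_deg_def)

lemma finite_shifted_trms: "finite (shifted_trms n a t)"
  by (simp add: shifted_trms_eq)

text \<open>For \<open>t < a \<le> n + t\<close> the binomial coefficient vanishes, as it should.\<close>

lemma card_shifted_trms: "a \<le> n + t \<Longrightarrow> card (shifted_trms n a t) = (n + t - a) choose n"
  by (auto simp: shifted_trms_eq card_trms_deg)

text \<open>The polynomial is a product of n linear factors divided by n!. For
  \<open>t < a <= n + t\<close> one factor is 0, as is the binomial coefficient; these additional
  degrees are what allows polynomiality from degree \<open>r\<close> on.\<close>

lemma binomial_poly:
  "\<exists>P :: rat poly. \<forall>t. a \<le> n + t \<longrightarrow> of_nat ((n + t - a) choose n) = poly P (of_nat t)"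
proof (intro exI allI impI)
  fix t assume t: "a \<le> n + t"
  let ?P = "smult (1 / fact n) (\<Prod>i<n. [:of_nat n - of_nat a - of_nat i, 1:]) :: rat poly"
  have "(of_nat ((n + t - a) choose n) :: rat) = (of_nat n - of_nat a + of_nat t) gchoose n"
    using t by (simp add: binomial_gbinomial of_nat_diff algebra_simps)
  also have "\<dots> = poly ?P (of_nat t)"
    by (simp add: gbinomial_prod_rev poly_prod atLeast0LessThan algebra_simps)
  finally show "(of_nat ((n + t - a) choose n) :: rat) = poly ?P (of_nat t)" .
qed

definition graded_piece :: "nat \<Rightarrow> nat \<Rightarrow> (nat \<Rightarrow> nat) \<Rightarrow> nat \<Rightarrow> (nat \<Rightarrow> 'a::field mpol) set" where
  "graded_piece n b a t =
     {v. \<forall>j. Poly_Mapping.keys (v j) \<subseteq> shifted_trms n (a j) t \<and> (b \<le> j \<longrightarrow> v j = 0)}"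

lemma subspace_graded_piece: "fv.subspace (graded_piece n b a t :: (nat \<Rightarrow> 'a::field mpol) set)"
proof (rule fv.subspaceI)
  fix v w :: "nat \<Rightarrow> 'a mpol" and c
  assume v: "v \<in> graded_piece n b a t"
  show "fsmul c v \<in> graded_piece n b a t"
    using v by (simp add: graded_piece_def fsmul_def subset_trans[OF keys_smul])
  assume w: "w \<in> graded_piece n b a t"
  show "v + w \<in> graded_piece n b a t"
    using v w by (simp add: graded_piece_def subset_trans[OF Poly_Mapping.keys_add])
qed (simp add: graded_piece_def)

text \<open>Induction on the rank, splitting off the last coordinate by rank-nullity. The finite
  spanning set is carried along because rank-nullity asks for one.\<close>

lemma graded_piece_dim:
  shows "\<exists>B. finite B \<and> graded_piece n b a t \<subseteq> fv.span (B :: (nat \<Rightarrow> 'a::field mpol) set)"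
    and "fv.dim (graded_piece n b a t :: (nat \<Rightarrow> 'a mpol) set) = (\<Sum>j<b. card (shifted_trms n (a j) t))"
proof (induction b)
  case 0
  have 0: "graded_piece n 0 a t = {0 :: nat \<Rightarrow> 'a mpol}" by (auto simp: graded_piece_def fun_eq_iff)
  case 1
  show ?case unfolding 0 by (intro exI[of _ "{}"]) simp
  case 2
  show ?case
    unfolding 0 using fv.dim_span_eq_card_independent[OF fv.independent_empty]
    by (simp only: fv.span_empty card.empty lessThan_0 sum.empty)
next
  case (Suc b)
  let ?G = "\<lambda>b. graded_piece n b a t :: (nat \<Rightarrow> 'a mpol) set" and ?X = "shifted_trms n (a b) t"
  obtain B where B: "finite B" "?G b \<subseteq> fv.span B" using Suc(1) by blast
  let ?B = "B \<union> at_index b ` mon ` ?X"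
  have "v \<in> fv.span ?B" if v: "v \<in> ?G (Suc b)" for v
  proof -
    have "v(b := 0) \<in> ?G b" using v by (auto simp: graded_piece_def le_less_Suc_eq)
    then have "v(b := 0) \<in> fv.span ?B"
      using B(2) fv.span_mono[of B ?B] by auto
    moreover have "v b \<in> mp.span (mon ` ?X)" using v by (auto simp: graded_piece_def span_mon)
    then have "at_index b (v b) \<in> fv.span ?B"
      using mfv.linear_span_image[OF linear_at_index, of b "mon ` ?X"]
        fv.span_mono[of "at_index b ` mon ` ?X" ?B] by auto
    ultimately have "v(b := 0) + at_index b (v b) \<in> fv.span ?B" by (rule fv.span_add)
    also have "v(b := 0) + at_index b (v b) = v" by (auto simp: at_index_def fun_eq_iff)
    finally show ?thesis .
  qed
  then have span: "?G (Suc b) \<subseteq> fv.span ?B" ..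
  have fin: "finite ?B" using B(1) finite_shifted_trms by auto
  case 1
  show ?case using span fin by blast
  case 2
  have "fv.dim (?G (Suc b)) = fv.dim {v \<in> ?G (Suc b). v b = 0} + mp.dim ((\<lambda>v. v b) ` ?G (Suc b))"
    by (rule fvm.dim_kernel_plus_dim_image[OF linear_coord subspace_graded_piece span fin])
  also have "{v \<in> ?G (Suc b). v b = 0} = ?G b"
  proof (intro equalityI subsetI)
    fix v assume v: "v \<in> {v \<in> ?G (Suc b). v b = 0}"
    then have "v j = 0" if "b \<le> j" for j
      using that by (cases "j = b") (auto simp: graded_piece_def)
    then show "v \<in> ?G b" using v by (simp add: graded_piece_def)
  qed (simp add: graded_piece_def)
  also have "(\<lambda>v. v b) ` ?G (Suc b) = {f. Poly_Mapping.keys f \<subseteq> ?X}"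
  proof (intro equalityI subsetI)
    fix f :: "'a mpol" assume "f \<in> {f. Poly_Mapping.keys f \<subseteq> ?X}"
    then have "at_index b f \<in> ?G (Suc b)" by (auto simp: at_index_def graded_piece_def)
    then show "f \<in> (\<lambda>v. v b) ` ?G (Suc b)" by (rule rev_image_eqI) (simp add: at_index_def)
  qed (auto simp: graded_piece_def)
  finally show ?case using Suc(2) by (simp add: dim_keys_subset)
qed

definition free_mod :: "nat \<Rightarrow> nat \<Rightarrow> (nat \<Rightarrow> 'a::field mpol) set" where
  "free_mod n b = {v. \<forall>j. v j \<in> polys n \<and> (b \<le> j \<longrightarrow> v j = 0)}"

definition mat_fun :: "nat \<Rightarrow> nat \<Rightarrow> (nat \<Rightarrow> nat \<Rightarrow> 'a::field mpol) \<Rightarrow> (nat \<Rightarrow> 'a mpol) \<Rightarrow> nat \<Rightarrow> 'a mpol" where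
  "mat_fun r c A v j = (if j < r then \<Sum>k<c. A j k * v k else 0)"

text \<open>Models a minimal resolution of an ideal augmented by \<open>S\<close> in position 0:
  \<open>N 0\<close> is the row of generators and the resolution itself starts in position 1.
  Minimality starts with \<open>N 1\<close>, since a generator may be a constant when the ideal is
  \<open>S\<close>.\<close>

locale graded_exact_complex =
  fixes n :: nat and b :: "nat \<Rightarrow> nat" and a :: "nat \<Rightarrow> nat \<Rightarrow> nat"
    and N :: "nat \<Rightarrow> nat \<Rightarrow> nat \<Rightarrow> 'a::field mpol"
  assumes homogeneous: "j < b i \<Longrightarrow> k < b (Suc i) \<Longrightarrow> s \<in> Poly_Mapping.keys (N i j k) \<Longrightarrow>
      s \<in> trms n \<and> tdeg s + a i j = a (Suc i) k"
    and exact: "mat_fun (b (Suc i)) (b (Suc (Suc i))) (N (Suc i)) ` free_mod n (b (Suc (Suc i))) =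
      {v \<in> free_mod n (b (Suc i)). mat_fun (b i) (b (Suc i)) (N i) v = 0}"
    and minimal: "j < b (Suc i) \<Longrightarrow> k < b (Suc (Suc i)) \<Longrightarrow> Poly_Mapping.lookup (N (Suc i) j k) 0 = 0"
begin

abbreviation F :: "nat \<Rightarrow> (nat \<Rightarrow> 'a mpol) set" where
  "F i \<equiv> free_mod n (b i)"

abbreviation d :: "nat \<Rightarrow> (nat \<Rightarrow> 'a mpol) \<Rightarrow> nat \<Rightarrow> 'a mpol" where
  "d i \<equiv> mat_fun (b i) (b (Suc i)) (N i)"

definition Ft :: "nat \<Rightarrow> nat \<Rightarrow> (nat \<Rightarrow> 'a mpol) set" where
  "Ft i t = graded_piece n (b i) (a i) t"

lemma N_polys: "j < b i \<Longrightarrow> k < b (Suc i) \<Longrightarrow> N i j k \<in> polys n"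
  using homogeneous by (auto simp: polys_def)

lemma d_F: "v \<in> F (Suc i) \<Longrightarrow> d i v \<in> F i"
  by (auto simp: free_mod_def mat_fun_def intro!: polys_sum polys_mult N_polys)

lemma d_d: "v \<in> F (Suc (Suc i)) \<Longrightarrow> d i (d (Suc i) v) = 0"
  using exact[of i] by blast

lemma d_add: "d i (v + w) = d i v + d i w"
  by (auto simp: mat_fun_def fun_eq_iff distrib_left sum.distrib)

lemma d_diff: "d i (v - w) = d i v - d i w"
  by (auto simp: mat_fun_def fun_eq_iff right_diff_distrib sum_subtractf)

lemma d_mult: "d i (\<lambda>k. f * v k) j = f * d i v j"
  by (auto simp: mat_fun_def sum_distrib_left intro!: sum.cong)

lemma linear_d: "Vector_Spaces.linear fsmul fsmul (d i)"
proof (rule Vector_Spaces.linear_iff[THEN iffD2], intro conjI allI)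
  show "d i (fsmul c v) = fsmul c (d i v)" for c v
    by (rule ext) (simp add: fsmul_def[abs_def] smul_def d_mult)
qed (rule fv.vector_space_axioms d_add)+

subsection \<open>Length of the complex\<close>

text \<open>Substitution of 0 for all variables from \<open>x_k\<close> on, a ring homomorphism.
  \<open>cut (Suc n)\<close> is the identity on \<open>S\<close>, and \<open>cut 0\<close> extracts
  the constant term.\<close>

definition cut :: "nat \<Rightarrow> 'a mpol \<Rightarrow> 'a mpol" where
  "cut k f = restr (\<lambda>t. Poly_Mapping.keys t \<subseteq> {..<k}) f"

lemma cut_mult: "cut k (f * g) = cut k f * cut k g"
proof -
  let ?P = "\<lambda>t :: trm. Poly_Mapping.keys t \<subseteq> {..<k}"
  have "f * g = cut k f * g + restr (\<lambda>t. \<not> ?P t) f * g"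
    by (simp add: cut_def restr_add_compl flip: distrib_right)
  moreover have "restr ?P (cut k f * g) = cut k f * restr ?P g"
    by (rule restr_mult) (auto simp: cut_def keys_add_nat)
  moreover have "restr ?P (restr (\<lambda>t. \<not> ?P t) f * g) = restr (\<lambda>t. \<not> ?P t) f * restr (\<lambda>t. False) g"
    by (rule restr_mult) (auto simp: keys_add_nat)
  moreover have "restr (\<lambda>t. False) g = 0" by (rule restr_eq_0) simp
  ultimately show ?thesis by (simp add: restr_add cut_def)
qed

lemma cut_zero [simp]: "cut k 0 = 0"
  by (simp add: cut_def)

lemma cut_sum: "cut k (sum f A) = (\<Sum>x\<in>A. cut k (f x))"
  by (simp add: cut_def restr_sum)

lemma cut_add: "cut k (f + g) = cut k f + cut k g"
  by (simp add: cut_def restr_add)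

lemma cut_diff: "cut k (f - g) = cut k f - cut k g"
  using cut_add[of k "f - g" g] by (simp add: algebra_simps)

lemma cut_cut [simp]: "l \<le> k \<Longrightarrow> cut l (cut k f) = cut l f"
  unfolding cut_def restr_restr by (rule poly_mapping_eqI) auto

text \<open>The differential descends to the complex in which the variables from \<open>x_l\<close>
  on are zero.\<close>

lemma cut_d_cong:
  assumes "\<And>k. cut l (v k) = cut l (w k)"
  shows "cut l (d i v j) = cut l (d i w j)"
  using assms by (simp add: mat_fun_def cut_sum cut_mult)

definition div_var :: "nat \<Rightarrow> 'a mpol \<Rightarrow> 'a mpol" where
  "div_var k f = (\<Sum>t\<in>Poly_Mapping.keys f.
     Poly_Mapping.single (t - var_trm k) (Poly_Mapping.lookup f t))"

text \<open>The terms of \<open>f\<close> involve no variable after \<open>x_k\<close>, and none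
  survives setting \<open>x_k\<close> to zero as well, so each contains \<open>x_k\<close>.\<close>

lemma mult_div_var:
  assumes "cut (Suc k) f = f" "cut k f = 0"
  shows "mon (var_trm k) * div_var k f = f"
proof -
  have k: "var_trm k + (t - var_trm k) = t" if t: "t \<in> Poly_Mapping.keys f" for t
  proof -
    have "Poly_Mapping.keys t \<subseteq> {..<Suc k}" "\<not> Poly_Mapping.keys t \<subseteq> {..<k}"
      using t arg_cong[OF assms(1), of Poly_Mapping.keys] arg_cong[OF assms(2), of Poly_Mapping.keys]
      by (auto simp: cut_def)
    then have "k \<in> Poly_Mapping.keys t" by (auto simp: less_Suc_eq)
    then show ?thesis
      by (intro poly_mapping_eqI)
        (auto simp: lookup_add lookup_minus var_trm_def lookup_single when_def in_keys_iff)
  qed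
  have "mon (var_trm k) * div_var k f =
      (\<Sum>t\<in>Poly_Mapping.keys f. Poly_Mapping.single t (Poly_Mapping.lookup f t))"
    by (auto simp: div_var_def mon_def sum_distrib_left Poly_Mapping.mult_single k intro!: sum.cong)
  also have "\<dots> = restr (\<lambda>t. True) f" by (simp add: restr_def)
  also have "\<dots> = f" by (rule restr_id) simp
  finally show ?thesis .
qed

lemma mon_mult_eq_0: "mon s * (f :: 'a mpol) = 0 \<Longrightarrow> f = 0"
  using keys_mon_mult[of s f] by (metis image_is_empty keys_eq_empty)

text \<open>
  Setting the last variable to zero preserves exactness, except in the last position: if
  \<open>d v\<close> is divisible by the regular element \<open>x\<^sub>k\<close>, then the quotient is a cycle, hence a boundary
  \<open>d z\<close>, and \<open>v - x\<^sub>k z\<close> is a cycle which is congruent to \<open>v\<close>.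
\<close>

lemma exact_cut:
  assumes "k + l = Suc n" "l \<le> i" "v \<in> F (Suc i)" "\<And>j. cut k (d i v j) = 0"
  shows "\<exists>y\<in>F (Suc (Suc i)). \<forall>j. cut k (v j) = cut k (d (Suc i) y j)"
  using assms
proof (induction l arbitrary: k i v)
  case 0
  have id: "cut (Suc n) f = f" if "f \<in> polys n" for f
    unfolding cut_def using that by (intro restr_id) (auto simp: polys_def trms_def lessThan_Suc_atMost)
  have "d i v = 0"
    using 0 d_F[OF 0(3)] id by (auto simp: free_mod_def fun_eq_iff)
  then have "v \<in> d (Suc i) ` F (Suc (Suc i))" unfolding exact using 0(3) by simp
  then show ?case by auto
next
  case (Suc l)
  \<comment> \<open>Each variable set to zero costs one position: the cycle \<open>w\<close> lives
    one place lower than \<open>v\<close>, which is why \<open>l <= i\<close> is required.\<close>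
  then obtain i' where i': "i = Suc i'" "l \<le> i'" by (cases i) auto
  have k: "Suc k + l = Suc n" "k \<le> n" using Suc.prems(1) by auto
  have x: "cut (Suc k) (mon (var_trm k)) = (mon (var_trm k) :: 'a mpol)"
    unfolding cut_def by (rule restr_id) (auto simp: var_trm_def)
  have x': "cut k (mon (var_trm k)) = (0 :: 'a mpol)"
    unfolding cut_def by (rule restr_eq_0) (auto simp: var_trm_def)
  define u where "u j = cut (Suc k) (d i v j)" for j
  define w where "w j = div_var k (u j)" for j
  have uw: "u j = mon (var_trm k) * w j" for j
    unfolding w_def by (rule mult_div_var[symmetric]) (simp_all add: u_def Suc.prems(4))
  have dv: "d i v \<in> F i" by (rule d_F[OF Suc.prems(3)])
  have w: "w \<in> F i"
  proof -
    have "w j \<in> polys n" for j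
    proof -
      have "u j \<in> polys n" using dv by (simp add: u_def cut_def free_mod_def polys_restr)
      then show ?thesis unfolding uw by (auto simp: polys_def keys_mon_mult trms_add)
    qed
    moreover have "w j = 0" if "b i \<le> j" for j
      using dv that by (simp add: w_def u_def free_mod_def div_var_def)
    ultimately show ?thesis by (simp add: free_mod_def)
  qed
  \<comment> \<open>Modulo the later variables, \<open>x_k\<close> times \<open>w\<close> equals
    \<open>d i v\<close>, which the next differential kills; multiplication by \<open>x_k\<close> is
    injective.\<close>
  have "cut (Suc k) (d i' w j) = 0" for j
  proof (rule mon_mult_eq_0)
    have "mon (var_trm k) * cut (Suc k) (d i' w j) = cut (Suc k) (d i' (\<lambda>j. mon (var_trm k) * w j) j)"
      by (simp add: d_mult cut_mult x)
    also have "\<dots> = cut (Suc k) (d i' (d i v) j)"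
      by (rule cut_d_cong) (simp add: uw[symmetric] u_def)
    also have "\<dots> = 0" using d_d[of v i'] Suc.prems(3) i' by simp
    finally show "mon (var_trm k) * cut (Suc k) (d i' w j) = 0" .
  qed
  then obtain z where z: "z \<in> F (Suc i)" "\<And>j. cut (Suc k) (w j) = cut (Suc k) (d i z j)"
    using Suc.IH[OF k(1) i'(2)] w i'(1) by blast
  define v' where "v' = v - (\<lambda>j. mon (var_trm k) * z j)"
  have "var_trm k \<in> trms n" using k(2) by (auto simp: trms_def var_trm_def)
  then have "(\<lambda>j. mon (var_trm k) * z j) \<in> F (Suc i)" using z(1) by (auto simp: free_mod_def polys_mult polys_mon)
  moreover have "f - g \<in> polys n" if "f \<in> polys n" "g \<in> polys n" for f g :: "'a mpol"
    using that keys_diff[of f g] by (auto simp: polys_def)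
  ultimately have v': "v' \<in> F (Suc i)" using Suc.prems(3) by (auto simp: free_mod_def v'_def)
  have "cut (Suc k) (d i v' j) = 0" for j
  proof -
    have "cut (Suc k) (d i v' j) = u j - mon (var_trm k) * cut (Suc k) (d i z j)"
      by (simp add: v'_def d_diff d_mult cut_diff cut_mult x u_def)
    also have "\<dots> = u j - cut (Suc k) (u j)" by (simp add: uw cut_mult x z(2))
    finally show ?thesis by (simp add: u_def)
  qed
  then obtain y where y: "y \<in> F (Suc (Suc i))" "\<And>j. cut (Suc k) (v' j) = cut (Suc k) (d (Suc i) y j)"
    using Suc.IH[OF k(1) _ v'] i' by auto
  have "cut k (v j) = cut k (d (Suc i) y j)" for j
  proof -
    have "cut k (v j) = cut k (v' j)" by (simp add: v'_def cut_diff cut_mult x')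
    also have "\<dots> = cut k (cut (Suc k) (v' j))" by simp
    also have "\<dots> = cut k (d (Suc i) y j)" by (simp add: y(2))
    finally show ?thesis .
  qed
  then show ?case using y(1) by blast
qed

text \<open>With all n + 1 variables set to zero, the minimal differentials vanish while exactness
  survives from position n + 2 on, so a unit vector there would be a cycle but not a boundary. As
  position 0 is the augmentation, the resolution has length at most n.\<close>

lemma rank_eq_0: "b (Suc (Suc (n + i))) = 0"
proof (rule ccontr)
  assume "b (Suc (Suc (n + i))) \<noteq> 0"
  then have b: "0 < b (Suc (Suc (n + i)))" by simp
  let ?v = "at_index 0 1 :: nat \<Rightarrow> 'a mpol"
  have cut0: "cut 0 f = Poly_Mapping.single 0 (Poly_Mapping.lookup f 0)" for f
    by (rule poly_mapping_eqI) (auto simp: cut_def lookup_single when_def)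
  have "cut 0 (N (Suc m) j k) = 0" if "j < b (Suc m)" "k < b (Suc (Suc m))" for m j k
    using that by (simp add: cut0 minimal)
  then have min: "cut 0 (d (Suc m) v j) = 0" for m v j
    by (simp add: mat_fun_def cut_sum cut_mult)
  have "?v \<in> F (Suc (Suc (n + i)))"
    using b by (auto simp: free_mod_def at_index_def polys_def)
  then obtain y where "\<And>j. cut 0 (?v j) = cut 0 (d (Suc (Suc (n + i))) y j)"
    using exact_cut[of 0 "Suc n" "Suc (n + i)" ?v] min by auto
  from this[of 0] show False unfolding min by (simp add: at_index_def cut0)
qed

subsection \<open>Hilbert function\<close>

lemma Ft_subset_F: "Ft i t \<subseteq> F i"
  by (auto simp: Ft_def free_mod_def graded_piece_def shifted_trms_def polys_def)

lemma d_Ft: "v \<in> Ft (Suc i) t \<Longrightarrow> d i v \<in> Ft i t"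
proof -
  assume v: "v \<in> Ft (Suc i) t"
  have "Poly_Mapping.keys (N i j k * v k) \<subseteq> shifted_trms n (a i j) t" if "j < b i" "k < b (Suc i)" for j k
  proof
    fix s assume "s \<in> Poly_Mapping.keys (N i j k * v k)"
    then obtain s1 s2 where s: "s = s1 + s2" "s1 \<in> Poly_Mapping.keys (N i j k)" "s2 \<in> Poly_Mapping.keys (v k)"
      using keys_mult[of "N i j k" "v k"] by auto
    then have "s2 \<in> shifted_trms n (a (Suc i) k) t" using v by (auto simp: Ft_def graded_piece_def)
    then show "s \<in> shifted_trms n (a i j) t"
      using homogeneous[OF that s(2)] s(1) by (auto simp: shifted_trms_def trms_add tdeg_add)
  qed
  then have "Poly_Mapping.keys (\<Sum>k<b (Suc i). N i j k * v k) \<subseteq> shifted_trms n (a i j) t" if "j < b i" for j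
    using that Poly_Mapping.keys_sum[of "\<lambda>k. N i j k * v k" "{..<b (Suc i)}"] by fastforce
  then show ?thesis by (auto simp: Ft_def graded_piece_def mat_fun_def)
qed

lemma d_Ft_eq: "d i ` Ft (Suc i) t = d i ` F (Suc i) \<inter> Ft i t"
proof (intro equalityI subsetI)
  fix u assume u: "u \<in> d i ` F (Suc i) \<inter> Ft i t"
  then obtain v where v: "v \<in> F (Suc i)" "u = d i v" by blast
  \<comment> \<open>The differential is homogeneous, so the degree t part of a preimage maps to the
    degree t part of \<open>u\<close>, which is \<open>u\<close> itself.\<close>
  define v' where "v' k = restr (\<lambda>s. tdeg s + a (Suc i) k = t) (v k)" for k
  have "v' \<in> Ft (Suc i) t"
    using v(1) by (auto simp: v'_def Ft_def graded_piece_def free_mod_def shifted_trms_def polys_def)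
  moreover have "d i v' j = u j" for j
  proof (cases "j < b i")
    case True
    have "restr (\<lambda>s. tdeg s + a i j = t) (N i j k * v k) = N i j k * v' k" if "k < b (Suc i)" for k
      unfolding v'_def using homogeneous[OF True that] by (intro restr_mult) (auto simp: tdeg_add)
    then have "d i v' j = restr (\<lambda>s. tdeg s + a i j = t) (u j)"
      using True by (simp add: mat_fun_def v(2) restr_sum)
    also have "\<dots> = u j"
      using u by (intro restr_id) (auto simp: Ft_def graded_piece_def shifted_trms_def)
    finally show ?thesis .
  qed (simp add: mat_fun_def v(2))
  ultimately show "u \<in> d i ` Ft (Suc i) t" by (intro image_eqI[of _ _ v']) auto
qed (use Ft_subset_F d_Ft in auto)

definition rk :: "nat \<Rightarrow> nat \<Rightarrow> nat" where
  "rk i t = fv.dim (d i ` Ft (Suc i) t)"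

text \<open>By exactness the kernel of one differential is the image of the next, so this is
  rank-nullity in degree t.\<close>

lemma rk_add_rk: "rk i t + rk (Suc i) t = (\<Sum>j<b (Suc i). card (shifted_trms n (a (Suc i) j) t))"
proof -
  obtain B :: "(nat \<Rightarrow> 'a mpol) set" where B: "finite B" "Ft (Suc i) t \<subseteq> fv.span B"
    using graded_piece_dim(1)[of n "b (Suc i)" "a (Suc i)" t] unfolding Ft_def by auto
  have "fv.dim (Ft (Suc i) t) = fv.dim {v \<in> Ft (Suc i) t. d i v = 0} + fv.dim (d i ` Ft (Suc i) t)"
    using B by (intro fvp.dim_kernel_plus_dim_image linear_d) (simp_all add: Ft_def subspace_graded_piece)
  also have "{v \<in> Ft (Suc i) t. d i v = 0} = d (Suc i) ` Ft (Suc (Suc i)) t"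
    unfolding d_Ft_eq exact using Ft_subset_F by auto
  finally show ?thesis by (simp add: rk_def Ft_def graded_piece_dim(2))
qed

text \<open>Descending induction from position n + 1, where the rank is 0: each rank is a sum of
  binomial coefficients minus the next rank.\<close>

lemma rk_eventually_poly:
  assumes a: "\<And>i j. j < b (Suc i) \<Longrightarrow> a (Suc i) j \<le> r + i"
  shows "\<exists>P :: rat poly. \<forall>t\<ge>r. of_nat (rk i t) = poly P (of_nat t)"
proof -
  have "\<exists>P :: rat poly. \<forall>t\<ge>r. of_nat (rk i t) = poly P (of_nat t)" if "i + l = Suc n" for i l
    using that
  proof (induction l arbitrary: i)
    case 0
    have "rk i t = 0" for t
      using rk_add_rk[of i t] rank_eq_0[of 0] 0 by simp
    then show ?case by (intro exI[of _ 0]) simp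
  next
    case (Suc l)
    have "Suc i + l = Suc n" using Suc.prems by simp
    from Suc.IH[OF this] obtain P :: "rat poly"
      where P: "\<forall>t\<ge>r. of_nat (rk (Suc i) t) = poly P (of_nat t)" ..
    have "\<exists>Q. \<forall>a t. a \<le> n + t \<longrightarrow> of_nat ((n + t - a) choose n) = poly (Q a :: rat poly) (of_nat t)"
      by (intro choice allI binomial_poly)
    then obtain Q :: "nat \<Rightarrow> rat poly"
      where Q: "\<forall>a t. a \<le> n + t \<longrightarrow> of_nat ((n + t - a) choose n) = poly (Q a) (of_nat t)" ..
    have "of_nat (rk i t) = poly ((\<Sum>j<b (Suc i). Q (a (Suc i) j)) - P) (of_nat t)" if t: "t \<ge> r" for t
    proof -
      \<comment> \<open>Here i <= n and t >= r, so the bound r + i lies in the range where the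
        binomial coefficients are polynomial.\<close>
      have "a (Suc i) j \<le> n + t" if "j < b (Suc i)" for j
        using assms[OF that] t Suc.prems by linarith
      then have "of_nat (rk i t + rk (Suc i) t) = (\<Sum>j<b (Suc i). poly (Q (a (Suc i) j)) (of_nat t))"
        unfolding rk_add_rk by (simp add: card_shifted_trms Q)
      then show ?thesis by (simp add: P[rule_format, OF t] poly_sum algebra_simps)
    qed
    then show ?case by blast
  qed
  then show ?thesis
  proof (cases "i \<le> Suc n")
    case False
    then have "rk i t = 0" for t
      using rk_add_rk[of i t] rank_eq_0[of "i - Suc n"] by simp
    then show ?thesis by (intro exI[of _ 0]) simp
  qed (metis le_add_diff_inverse)
qed

end

section \<open>From a minimal resolution to the Hilbert function of a regular ideal\<close>

definition vec_fun :: "'a::field mpol vec \<Rightarrow> nat \<Rightarrow> 'a mpol" where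
  "vec_fun v j = (if j < dim_vec v then v $ j else 0)"

lemma dim_at_index:
  fixes U :: "'a::field mpol set"
  assumes "mp.subspace U" "U \<subseteq> mp.span B" "finite B"
  shows "fv.dim (at_index 0 ` U) = mp.dim U"
proof -
  have "at_index 0 f = 0 \<longleftrightarrow> f = 0" for f :: "'a mpol"
    by (auto simp: at_index_def fun_eq_iff)
  then have "{f \<in> U. at_index 0 f = 0} = {0}" using mp.subspace_0[OF assms(1)] by auto
  then show ?thesis
    using mfv.dim_kernel_plus_dim_image[OF linear_at_index assms, of 0] by (simp add: dim_zero_space)
qed

lemma homogeneous_ideal_subspace:
  assumes "homogeneous_ideal n I"
  shows "mp.subspace I"
  using assms unfolding homogeneous_ideal_def is_ideal_def
  by (intro mp.subspaceI) (auto simp: smul_def polys_const)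

lemma regular_hilbert_function_poly:
  fixes I :: "'a::field mpol set"
  assumes I: "homogeneous_ideal n I" and "regular n r I"
  shows "\<exists>P :: rat poly. \<forall>t\<ge>r. of_nat (mp.dim (I \<inter> polys_deg n t)) = poly P (of_nat t)"
proof -
  from assms(2)[unfolded regular_def] obtain b a \<phi> M
    where *: "minimal_resolution n I b a \<phi> M \<and> (\<forall>i. \<forall>j<b i. a i j \<le> r + i)"
    by (elim exE)
  note a = conjunct2[OF *, rule_format]
  note res = conjunct1[OF *, unfolded minimal_resolution_def]
  note \<phi> = res[THEN conjunct2, THEN conjunct1, rule_format]
  note res1 = res[THEN conjunct2, THEN conjunct2]
  note M = res1[THEN conjunct1, rule_format]
  note degM = res1[THEN conjunct2, THEN conjunct1, rule_format]
  note res2 = res1[THEN conjunct2, THEN conjunct2]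
  note minM = res2[THEN conjunct1, rule_format]
  note im\<phi> = res2[THEN conjunct2, THEN conjunct1]
  note res3 = res2[THEN conjunct2, THEN conjunct2]
  note ex0 = res3[THEN conjunct1]
  note ex = res3[THEN conjunct2, rule_format]
  \<comment> \<open>The resolution is shifted by one position and \<open>S\<close> is put in
    position 0, so that the image of \<open>?d 0\<close> is the ideal.\<close>
  define b' where "b' i = (case i of 0 \<Rightarrow> 1 | Suc i \<Rightarrow> b i)" for i
  define a' where "a' i j = (case i of 0 \<Rightarrow> 0 | Suc i \<Rightarrow> a i j)" for i j
  define N where "N i j k = (case i of 0 \<Rightarrow> \<phi> $ k | Suc i \<Rightarrow> M i $$ (j, k))" for i j k
  let ?F = "\<lambda>i. free_mod n (b' i) :: (nat \<Rightarrow> 'a mpol) set"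
  let ?d = "\<lambda>i. mat_fun (b' i) (b' (Suc i)) (N i)"
  have F_Suc: "?F (Suc i) = vec_fun ` vecs n (b i)" for i
  proof (intro equalityI subsetI)
    fix u assume u: "u \<in> ?F (Suc i)"
    then have "vec (b i) u \<in> vecs n (b i)" "u = vec_fun (vec (b i) u)"
      by (auto simp: free_mod_def b'_def vecs_def vec_fun_def fun_eq_iff)
    then show "u \<in> vec_fun ` vecs n (b i)" by blast
  qed (auto simp: free_mod_def b'_def vecs_def vec_fun_def)
  have dim\<phi>: "dim_vec \<phi> = b 0" using res[THEN conjunct1] by simp
  have d0: "?d 0 (vec_fun v) = at_index 0 (\<phi> \<bullet> v)" if "v \<in> vecs n (b 0)" for v
    using that by (auto simp: mat_fun_def b'_def N_def at_index_def vecs_def vec_fun_def scalar_prod_def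
        atLeast0LessThan fun_eq_iff)
  have dSuc: "?d (Suc i) (vec_fun v) = vec_fun (M i *\<^sub>v v)" if "v \<in> vecs n (b (Suc i))" for i v
    using that M[of i] by (auto simp: mat_fun_def b'_def N_def vecs_def vec_fun_def scalar_prod_def
        atLeast0LessThan fun_eq_iff intro!: sum.cong)
  have vec_fun_0: "vec_fun v = 0 \<longleftrightarrow> v = 0\<^sub>v k" if "v \<in> carrier_vec k" for v and k
    using that by (auto simp: vec_fun_def fun_eq_iff)
  have exact: "?d (Suc i) ` ?F (Suc (Suc i)) = {v \<in> ?F (Suc i). ?d i v = 0}" for i
  proof -
    have "?d (Suc i) ` ?F (Suc (Suc i)) = vec_fun ` (\<lambda>w. M i *\<^sub>v w) ` vecs n (b (Suc i))"
      unfolding F_Suc image_image by (intro image_cong refl dSuc)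
    also have "\<dots> = vec_fun ` {v \<in> vecs n (b i). ?d i (vec_fun v) = 0}"
    proof (intro arg_cong[of _ _ "image vec_fun"])
      show "(\<lambda>w. M i *\<^sub>v w) ` vecs n (b (Suc i)) = {v \<in> vecs n (b i). ?d i (vec_fun v) = 0}"
      proof (cases i)
        case 0
        have "at_index 0 f = 0 \<longleftrightarrow> f = 0" for f :: "'a mpol"
          by (auto simp: at_index_def fun_eq_iff)
        then show ?thesis using ex0 d0 0 by auto
      next
        case (Suc i')
        have "?d i (vec_fun v) = 0 \<longleftrightarrow> M i' *\<^sub>v v = 0\<^sub>v (b i')" if v: "v \<in> vecs n (b i)" for v
        proof -
          have "M i' *\<^sub>v v \<in> carrier_vec (b i')"
            using v M[of i'] unfolding Suc by (intro mult_mat_vec_carrier) (auto simp: vecs_def)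
          then show ?thesis using vec_fun_0 v unfolding Suc by (simp add: dSuc)
        qed
        then show ?thesis using ex[of i'] unfolding Suc by auto
      qed
    qed
    also have "\<dots> = {v \<in> ?F (Suc i). ?d i v = 0}" unfolding F_Suc by auto
    finally show ?thesis .
  qed
  interpret graded_exact_complex n b' a' N
  proof
    show "s \<in> trms n \<and> tdeg s + a' i j = a' (Suc i) k"
      if "j < b' i" "k < b' (Suc i)" "s \<in> Poly_Mapping.keys (N i j k)" for i j k s
      using that \<phi> degM
      by (cases i) (auto simp: a'_def b'_def N_def polys_deg_def trms_deg_def)
    show "Poly_Mapping.lookup (N (Suc i) j k) 0 = 0" if "j < b' (Suc i)" "k < b' (Suc (Suc i))" for i j k
      using that minM by (simp add: b'_def N_def)
  qed (rule exact)
  have "rk 0 t = mp.dim (I \<inter> polys_deg n t)" for t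
  proof -
    have "?d 0 ` ?F (Suc 0) = at_index 0 ` I"
      unfolding F_Suc im\<phi>[symmetric] image_image by (intro image_cong refl d0)
    moreover have "at_index 0 f \<in> Ft 0 t \<longleftrightarrow> f \<in> polys_deg n t" for f
      by (auto simp: Ft_def graded_piece_def at_index_def b'_def a'_def shifted_trms_eq polys_deg_def)
    ultimately have "?d 0 ` Ft (Suc 0) t = at_index 0 ` (I \<inter> polys_deg n t)"
      unfolding d_Ft_eq by auto
    then show ?thesis
      unfolding rk_def
      using dim_at_index[of "I \<inter> polys_deg n t" "mon ` trms_deg n t"]
        mp.subspace_inter[OF homogeneous_ideal_subspace[OF I] subspace_polys_deg]
      by (simp add: polys_deg_eq_span)
  qed
  moreover have "a' (Suc i) j \<le> r + i" if "j < b' (Suc i)" for i j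
    using that a by (simp add: a'_def b'_def)
  ultimately show ?thesis
    using rk_eventually_poly[of r 0] by auto
qed

section \<open>Saturated monomial ideals\<close>

text \<open>One coordinate at a time: a sequence of naturals has a monotone subsequence, and a
  nonincreasing one is constant once it has reached its minimum.\<close>

lemma incseq_subseq_coords:
  fixes f :: "nat \<Rightarrow> trm"
  shows "\<exists>\<phi>::nat \<Rightarrow> nat. strict_mono \<phi> \<and>
    (\<forall>v<k. \<forall>i j. i \<le> j \<longrightarrow> Poly_Mapping.lookup (f (\<phi> i)) v \<le> Poly_Mapping.lookup (f (\<phi> j)) v)"
proof (induction k)
  case 0
  show ?case by (intro exI[of _ id]) (simp add: strict_mono_def)
next
  case (Suc k)
  then obtain \<phi> :: "nat \<Rightarrow> nat" where \<phi>: "strict_mono \<phi>"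
    "\<And>v i j. v < k \<Longrightarrow> i \<le> j \<Longrightarrow> Poly_Mapping.lookup (f (\<phi> i)) v \<le> Poly_Mapping.lookup (f (\<phi> j)) v"
    by auto
  define g where "g i = Poly_Mapping.lookup (f (\<phi> i)) k" for i
  obtain \<psi> where \<psi>: "strict_mono \<psi>" "monoseq (\<lambda>i. g (\<psi> i))" using seq_monosub by blast
  have "\<exists>\<chi>::nat \<Rightarrow> nat. strict_mono \<chi> \<and> (\<forall>i j. i \<le> j \<longrightarrow> g (\<psi> (\<chi> i)) \<le> g (\<psi> (\<chi> j)))"
  proof (cases "\<forall>i j. i \<le> j \<longrightarrow> g (\<psi> i) \<le> g (\<psi> j)")
    case True
    then show ?thesis by (intro exI[of _ id]) (simp add: strict_mono_def)
  next
    case False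
    then have dec: "g (\<psi> j) \<le> g (\<psi> i)" if "i \<le> j" for i j
      using \<psi>(2) that unfolding monoseq_def by auto
    obtain i0 where i0: "\<And>i. g (\<psi> i0) \<le> g (\<psi> i)"
      using ex_has_least_nat[of "\<lambda>_. True" 0 "\<lambda>i. g (\<psi> i)"] by auto
    have "g (\<psi> (i + i0)) = g (\<psi> i0)" for i using dec[of i0 "i + i0"] i0 by (simp add: le_antisym)
    then show ?thesis by (intro exI[of _ "\<lambda>i. i + i0"]) (simp add: strict_mono_def)
  qed
  then obtain \<chi> :: "nat \<Rightarrow> nat" where \<chi>: "strict_mono \<chi>"
    "\<And>i j. i \<le> j \<Longrightarrow> g (\<psi> (\<chi> i)) \<le> g (\<psi> (\<chi> j))" by auto
  let ?\<phi> = "\<lambda>i. \<phi> (\<psi> (\<chi> i))"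
  have "strict_mono ?\<phi>"
    using \<phi>(1) \<psi>(1) \<chi>(1) by (simp add: strict_mono_def)
  moreover have "Poly_Mapping.lookup (f (?\<phi> i)) v \<le> Poly_Mapping.lookup (f (?\<phi> j)) v"
    if "v < Suc k" "i \<le> j" for v i j
  proof (cases "v = k")
    case True
    then show ?thesis using \<chi>(2)[OF that(2)] by (simp add: g_def)
  next
    case False
    have "\<psi> (\<chi> i) \<le> \<psi> (\<chi> j)"
      using that(2) \<psi>(1) \<chi>(1) by (simp add: strict_mono_less_eq)
    then show ?thesis using \<phi>(2) that False by simp
  qed
  ultimately show ?case by blast
qed

lemma trm_le_imp_factor:
  fixes s t :: trm
  assumes "t \<in> trms n" "\<And>v. v < Suc n \<Longrightarrow> Poly_Mapping.lookup s v \<le> Poly_Mapping.lookup t v" "s \<in> trms n"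
  shows "\<exists>u\<in>trms n. t = u + s"
proof
  have "Poly_Mapping.lookup s v \<le> Poly_Mapping.lookup t v" for v
  proof (cases "v < Suc n")
    case False
    then have "v \<notin> Poly_Mapping.keys s" using assms(3) by (auto simp: trms_def)
    then show ?thesis by (simp add: in_keys_iff)
  qed (rule assms(2))
  then show "t = (t - s) + s"
    by (intro poly_mapping_eqI) (simp add: lookup_add lookup_minus)
  then show "t - s \<in> trms n" using assms(1) trms_add[of "t - s" s n] by simp
qed

lemma dickson_trms:
  assumes "A \<subseteq> trms n"
  shows "\<exists>B\<subseteq>A. finite B \<and> (\<forall>t\<in>A. \<exists>s\<in>B. \<exists>u\<in>trms n. t = u + s)"
proof -
  \<comment> \<open>The elements of \<open>A\<close> that are minimal under divisibility. By the
    subsequence lemma an infinite \<open>B\<close> would contain two different terms, one dividing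
    the other.\<close>
  define B where "B = {t \<in> A. \<forall>s\<in>A. \<forall>u\<in>trms n. t = u + s \<longrightarrow> s = t}"
  have "finite B"
  proof (rule ccontr)
    assume "infinite B"
    then obtain f :: "nat \<Rightarrow> trm" where f: "inj f" "range f \<subseteq> B"
      using infinite_countable_subset by auto
    obtain \<phi> :: "nat \<Rightarrow> nat" where \<phi>: "strict_mono \<phi>"
      "\<forall>v<Suc n. \<forall>i j. i \<le> j \<longrightarrow> Poly_Mapping.lookup (f (\<phi> i)) v \<le> Poly_Mapping.lookup (f (\<phi> j)) v"
      using incseq_subseq_coords[of "Suc n" f] by auto
    have fB: "f i \<in> B" "f i \<in> A" for i using f(2) by (auto simp: B_def)
    have "\<exists>u\<in>trms n. f (\<phi> 1) = u + f (\<phi> 0)"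
      using \<phi>(2) fB(2) assms by (intro trm_le_imp_factor) auto
    then have "f (\<phi> 0) = f (\<phi> 1)" using fB(1)[of "\<phi> 1"] fB(2)[of "\<phi> 0"] by (auto simp: B_def)
    then have "\<phi> 0 = \<phi> 1" using f(1) by (auto dest: injD)
    then show False using strict_monoD[OF \<phi>(1), of 0 1] by simp
  qed
  moreover have "\<exists>s\<in>B. \<exists>u\<in>trms n. t = u + s" if t: "t \<in> A" for t
  proof -
    \<comment> \<open>A divisor of \<open>t\<close> in \<open>A\<close> of least degree is minimal:
      any further divisor leaves a cofactor of degree 0.\<close>
    let ?P = "\<lambda>s. s \<in> A \<and> (\<exists>u\<in>trms n. t = u + s)"
    have "?P t" using t by (auto intro!: bexI[of _ 0])
    then obtain s where s: "?P s" "\<And>s'. ?P s' \<Longrightarrow> tdeg s \<le> tdeg s'"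
      using ex_has_least_nat[of ?P t tdeg] by auto
    have "s' = s" if s': "s' \<in> A" "u' \<in> trms n" "s = u' + s'" for s' u'
    proof -
      obtain u where "u \<in> trms n" "t = u + s" using s(1) by auto
      then have "?P s'" using s' by (auto intro!: bexI[of _ "u + u'"] simp: add.assoc trms_add)
      then have "tdeg u' = 0" using s(2)[of s'] s'(3) by (simp add: tdeg_add)
      then have "u' = 0"
        by (intro poly_mapping_eqI) (auto simp: tdeg_def in_keys_iff)
      then show ?thesis using s'(3) by simp
    qed
    then have "s \<in> B" using s(1) by (auto simp: B_def)
    then show ?thesis using s(1) by blast
  qed
  ultimately show ?thesis by (intro exI[of _ B]) (auto simp: B_def)
qed

section \<open>Saturation of a set of terms\<close>

lemma trms_deg_split:
  "u \<in> trms_deg n (a + b) \<Longrightarrow> \<exists>u1\<in>trms_deg n a. \<exists>u2\<in>trms_deg n b. u = u1 + u2"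
proof (induction a arbitrary: u)
  case 0
  then show ?case by (intro bexI[of _ 0] bexI[of _ u]) (simp_all add: trms_deg_def)
next
  case (Suc a)
  then have u: "u \<in> trms n" "tdeg u = Suc (a + b)" by (auto simp: trms_deg_def)
  then have "Poly_Mapping.keys u \<noteq> {}" by (auto simp: tdeg_def)
  then obtain i where i: "i \<in> Poly_Mapping.keys u" by blast
  have eq: "u = var_trm i + (u - var_trm i)"
    using i by (intro poly_mapping_eqI)
      (auto simp: lookup_add lookup_minus var_trm_def lookup_single when_def in_keys_iff)
  have "u - var_trm i \<in> trms_deg n (a + b)"
    using u arg_cong[OF eq, of tdeg] arg_cong[OF eq, of "\<lambda>u. u \<in> trms n"]
    by (simp add: trms_deg_def tdeg_add trms_add var_trm_def)
  then obtain u1 u2 where u12: "u1 \<in> trms_deg n a" "u2 \<in> trms_deg n b" "u - var_trm i = u1 + u2"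
    using Suc.IH by blast
  have "var_trm i \<in> trms n" using i u(1) by (auto simp: trms_def var_trm_def)
  then have "var_trm i + u1 \<in> trms_deg n (Suc a)"
    using u12(1) by (simp add: trms_deg_def tdeg_add trms_add) (simp add: var_trm_def)
  moreover have "u = (var_trm i + u1) + u2" using eq u12(3) by (simp add: add.assoc)
  ultimately show ?case using u12(2) by blast
qed

text \<open>Saturation of a monomial ideal at the level of terms. No field is involved, so it can
  lead from an ideal over the extension field to one over the base field.\<close>

definition trms_sat :: "nat \<Rightarrow> trm set \<Rightarrow> trm set" where
  "trms_sat n T = {t \<in> trms n. \<exists>k. \<forall>u\<in>trms_deg n k. u + t \<in> T}"

context
  fixes n :: nat and T :: "trm set"
  assumes T_trms: "T \<subseteq> trms n" and T_add: "\<And>s t. t \<in> T \<Longrightarrow> s \<in> trms n \<Longrightarrow> s + t \<in> T"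
begin

lemma subset_trms_sat: "T \<subseteq> trms_sat n T"
  using T_trms T_add by (auto simp: trms_sat_def trms_deg_def)

lemma trms_sat_add: "t \<in> trms_sat n T \<Longrightarrow> s \<in> trms n \<Longrightarrow> s + t \<in> trms_sat n T"
  unfolding trms_sat_def using T_add by (fastforce simp: trms_add add.left_commute)

lemma trms_sat_exponent_mono:
  assumes "\<And>u. u \<in> trms_deg n k \<Longrightarrow> u + t \<in> T" "k \<le> l" "u \<in> trms_deg n l"
  shows "u + t \<in> T"
proof -
  have "u \<in> trms_deg n ((l - k) + k)" using assms(2,3) by simp
  then obtain u1 u2 where u: "u1 \<in> trms_deg n (l - k)" "u2 \<in> trms_deg n k" "u = u1 + u2"
    using trms_deg_split by blast
  have "u1 + (u2 + t) \<in> T" using u by (intro T_add assms(1)) (auto simp: trms_deg_def)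
  then show ?thesis by (simp add: u(3) add.assoc)
qed

text \<open>Only finitely many \<open>u\<close> of degree k occur, so the sum of the exponents they
  need is a common bound; adding k to it gives an exponent for \<open>t\<close>.\<close>

lemma trms_sat_saturated:
  assumes t: "t \<in> trms n" and k: "\<And>u. u \<in> trms_deg n k \<Longrightarrow> u + t \<in> trms_sat n T"
  shows "t \<in> trms_sat n T"
proof -
  have "\<forall>u\<in>trms_deg n k. \<exists>l. \<forall>v\<in>trms_deg n l. v + (u + t) \<in> T"
    using k by (auto simp: trms_sat_def)
  then have "\<exists>l. \<forall>u\<in>trms_deg n k. \<forall>v\<in>trms_deg n (l u). v + (u + t) \<in> T" by (rule bchoice)
  then obtain l where l: "\<forall>u\<in>trms_deg n k. \<forall>v\<in>trms_deg n (l u). v + (u + t) \<in> T" ..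
  define m where "m = (\<Sum>u\<in>trms_deg n k. l u)"
  have "w + t \<in> T" if w0: "w \<in> trms_deg n (m + k)" for w
  proof -
    obtain v u where w: "v \<in> trms_deg n m" "u \<in> trms_deg n k" "w = v + u"
      using trms_deg_split[OF w0] by blast
    have "l u \<le> m" unfolding m_def using w(2) by (intro member_le_sum) auto
    then have "v + (u + t) \<in> T"
      using trms_sat_exponent_mono[of "l u" "u + t" m v] l w by blast
    then show ?thesis by (simp add: w(3) add.assoc)
  qed
  then show ?thesis unfolding trms_sat_def using t by blast
qed

text \<open>By Dickson the saturation has finitely many generators. From a degree exceeding all
  their degrees plus exponents, every cofactor is large enough to bring the product into
  \<open>T\<close>.\<close>

lemma trms_sat_eventually:
  "\<exists>d0. \<forall>t\<in>trms_sat n T. d0 \<le> tdeg t \<longrightarrow> t \<in> T"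
proof -
  obtain B where B: "B \<subseteq> trms_sat n T" "finite B"
    "\<forall>t\<in>trms_sat n T. \<exists>s\<in>B. \<exists>u\<in>trms n. t = u + s"
    using dickson_trms[of "trms_sat n T" n] by (auto simp: trms_sat_def)
  have "\<forall>s\<in>B. \<exists>k. \<forall>u\<in>trms_deg n k. u + s \<in> T"
    using B(1) by (auto simp: trms_sat_def)
  then have "\<exists>k. \<forall>s\<in>B. \<forall>u\<in>trms_deg n (k s). u + s \<in> T" by (rule bchoice)
  then obtain k where k: "\<forall>s\<in>B. \<forall>u\<in>trms_deg n (k s). u + s \<in> T" ..
  have "t \<in> T" if t: "t \<in> trms_sat n T" "(\<Sum>s\<in>B. tdeg s + k s) \<le> tdeg t" for t
  proof -
    obtain s u where s: "s \<in> B" "u \<in> trms n" "t = u + s" using B(3) t(1) by blast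
    have "tdeg s + k s \<le> tdeg t"
      using member_le_sum[of s B "\<lambda>s. tdeg s + k s"] s(1) B(2) t(2) by simp
    then have "k s \<le> tdeg u" by (simp add: s(3) tdeg_add)
    then show ?thesis
      using trms_sat_exponent_mono[of "k s" s "tdeg u" u] k s by (simp add: trms_deg_def)
  qed
  then show ?thesis by blast
qed

lemma
  fixes J :: "'k::field mpol set"
  defines "J \<equiv> {f. Poly_Mapping.keys f \<subseteq> trms_sat n T}"
  shows trms_sat_homogeneous_ideal: "homogeneous_ideal n J"
    and sat_trms_sat: "sat n J = J"
proof -
  have polys: "J \<subseteq> polys n" by (auto simp: J_def polys_def trms_sat_def)
  have mult: "h * f \<in> J" if "h \<in> polys n" "f \<in> J" for h f
    using that keys_mult[of h f] trms_sat_add by (fastforce simp: J_def polys_def)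
  have add: "f + g \<in> J" if "f \<in> J" "g \<in> J" for f g
    using that Poly_Mapping.keys_add[of f g] by (auto simp: J_def)
  have "is_ideal n J"
    unfolding is_ideal_def using polys mult add by (auto simp: J_def)
  then show "homogeneous_ideal n J"
    unfolding homogeneous_ideal_def by (auto simp: J_def hom_comp_eq_restr)
  show "sat n J = J"
  proof (intro equalityI subsetI)
    fix f assume "f \<in> sat n J"
    then obtain k where f: "f \<in> polys n" "\<forall>u\<in>trms_deg n k. mon u * f \<in> J"
      by (auto simp: sat_def)
    have "t \<in> trms_sat n T" if t: "t \<in> Poly_Mapping.keys f" for t
    proof (rule trms_sat_saturated)
      show "t \<in> trms n" using t f(1) by (auto simp: polys_def)
      show "u + t \<in> trms_sat n T" if "u \<in> trms_deg n k" for u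
        using f(2) that t by (auto simp: J_def keys_mon_mult)
    qed
    then show "f \<in> J" by (auto simp: J_def)
  next
    fix f assume f: "f \<in> J"
    have "\<forall>t\<in>trms_deg n 0. mon t * f \<in> J"
      using mult f by (auto simp: trms_deg_def polys_mon)
    then show "f \<in> sat n J" using f polys unfolding sat_def by blast
  qed
qed

end

section \<open>Hilbert polynomials and the dimension in degree m\<close>

lemma poly_eqI_eventually_nat:
  fixes P Q :: "rat poly"
  assumes "\<And>t. N \<le> t \<Longrightarrow> poly P (of_nat t) = poly Q (of_nat t)"
  shows "P = Q"
proof (rule ccontr)
  assume "P \<noteq> Q"
  then have "finite {x. poly (P - Q) x = 0}" by (intro poly_roots_finite) simp
  moreover have "of_nat ` {N..} \<subseteq> {x. poly (P - Q) x = 0}" using assms by auto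
  ultimately have "finite (of_nat ` {N..} :: rat set)" by (rule finite_subset[rotated])
  then have "finite {N..}" by (rule finite_imageD) (auto simp: inj_on_def)
  then show False by (simp add: infinite_Ici)
qed

text \<open>Regularity makes the dimension polynomial from degree \<open>r\<close> on, and
  \<open>p\<close> prescribes it in large degrees. Polynomials agreeing at all large integers are
  equal, so the prescribed value is attained already at \<open>m\<close>.\<close>

lemma dim_subscheme_component:
  fixes J :: "'k::field mpol set"
  assumes J: "J \<in> subschemes n p" and r: "is_gotzmann_number TYPE('k) n p r" "r \<le> m"
  shows "rat_of_nat (mp.dim (J \<inter> polys_deg n m)) = of_nat ((n + m) choose n) - poly p (of_nat m)"
proof -
  have hom: "homogeneous_ideal n J" and reg: "regular n r J"
    using J r(1) by (auto simp: subschemes_def is_gotzmann_number_def)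
  from regular_hilbert_function_poly[OF hom reg] obtain P :: "rat poly"
    where P: "\<forall>t\<ge>r. of_nat (mp.dim (J \<inter> polys_deg n t)) = poly P (of_nat t)" ..
  from binomial_poly[of 0 n] obtain Q :: "rat poly"
    where "\<forall>t. 0 \<le> n + t \<longrightarrow> of_nat ((n + t - 0) choose n) = poly Q (of_nat t)" ..
  then have Q: "of_nat ((n + t) choose n) = poly Q (of_nat t)" for t by simp
  from J obtain t0 where t0: "\<forall>t\<ge>t0. rat_of_int (hilb_fun n J t) = poly p (rat_of_nat t)"
    by (auto simp: subschemes_def)
  have "Q - P = p"
  proof (rule poly_eqI_eventually_nat[of "max r t0"])
    fix t assume "max r t0 \<le> t"
    then show "poly (Q - P) (of_nat t) = poly p (of_nat t)"
      using t0[rule_format, of t] P[rule_format, of t]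
      by (simp add: hilb_fun_def dim_polys_deg flip: Q)
  qed
  then show ?thesis using P[rule_format, OF r(2)] Q[of m] by auto
qed

section \<open>The degree m component of the double-generic initial ideal\<close>

context ordered_terms
begin

lemma sat_ideal_gen_vs_component:
  fixes W :: "'a::field mpol set"
  assumes W: "W \<in> hilb n p m q" "LT W = set L"
    and r: "is_gotzmann_number TYPE('k::field) n p r" "r \<le> m"
    and q: "rat_of_nat q = rat_of_nat ((n + m) choose n) - poly p (rat_of_nat m)"
  shows "sat n (ideal_gen n (vs L)) \<inter> polys_deg n m = (vs L :: 'k mpol set)"
proof -
  from W(1) obtain I where I: "I \<in> subschemes n p" "W = I \<inter> polys_deg n m" and grass: "W \<in> grass n m q"
    by (auto simp: hilb_def)
  have hom: "homogeneous_ideal n I" using I(1) by (simp add: subschemes_def)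
  have mult: "mon s * f \<in> I" if "f \<in> I" "s \<in> trms n" for f s
    using hom that polys_mon[of s n] by (auto simp: homogeneous_ideal_def is_ideal_def)
  \<comment> \<open>The leading terms of the homogeneous elements of \<open>I\<close>; the number of
    those of degree d is the dimension of the degree d component.\<close>
  define T where "T = {t. t \<in> LT (I \<inter> polys_deg n (tdeg t))}"
  have T_deg: "{t \<in> T. tdeg t = d} = LT (I \<inter> polys_deg n d)" for d
    using LT_subset[of "I \<inter> polys_deg n d" d] by (auto simp: T_def trms_deg_def)
  have T_trms: "T \<subseteq> trms n"
  proof
    fix t assume "t \<in> T"
    then show "t \<in> trms n"
      using LT_subset[of "I \<inter> polys_deg n (tdeg t)" "tdeg t"] by (auto simp: T_def trms_deg_def)
  qed
  have T_add: "s + t \<in> T" if t: "t \<in> T" and s: "s \<in> trms n" for s t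
  proof -
    obtain f where f: "f \<in> I" "f \<in> polys_deg n (tdeg t)" "lead t f" using t by (auto simp: T_def LT_def)
    have "lead (s + t) (mon s * f)"
      using lead_mon_mult f(2,3) s polys_deg_subset_polys by blast
    moreover have "mon s * f \<in> polys_deg n (tdeg (s + t))"
      using f(2) s by (auto simp: polys_deg_def trms_deg_def keys_mon_mult trms_add tdeg_add)
    ultimately show ?thesis using mult[OF f(1) s] by (auto simp: T_def LT_def)
  qed
  \<comment> \<open>\<open>J\<close> lives over the base field, the field for which \<open>r\<close>
    is the Gotzmann number; only the terms in \<open>T\<close> are taken from
    \<open>I\<close>.\<close>
  define J where "J = {f :: 'k mpol. Poly_Mapping.keys f \<subseteq> trms_sat n T}"
  have homJ: "homogeneous_ideal n J" and satJ: "sat n J = J"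
    unfolding J_def using trms_sat_homogeneous_ideal[OF T_trms T_add] sat_trms_sat[OF T_trms T_add] by auto
  have J_deg: "J \<inter> polys_deg n d = {f. Poly_Mapping.keys f \<subseteq> {t \<in> trms_sat n T. tdeg t = d}}" for d
    by (auto simp: J_def polys_deg_def trms_deg_def trms_sat_def)
  have dimI: "mp.dim (I \<inter> polys_deg n d) = card {t \<in> T. tdeg t = d}" for d
    unfolding T_deg using mp.subspace_inter[OF homogeneous_ideal_subspace[OF hom] subspace_polys_deg]
    by (intro card_LT[symmetric]) auto
  have "J \<in> subschemes n p"
  proof -
    obtain d0 where d0: "\<forall>t\<in>trms_sat n T. d0 \<le> tdeg t \<longrightarrow> t \<in> T"
      using trms_sat_eventually[OF T_trms T_add] by auto
    \<comment> \<open>Both dimensions are numbers of terms, so the two Hilbert functions can be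
      compared across different fields.\<close>
    have "hilb_fun n J d = hilb_fun n I d" if "d0 \<le> d" for d
    proof -
      have "{t \<in> trms_sat n T. tdeg t = d} = {t \<in> T. tdeg t = d}"
        using d0 that subset_trms_sat[OF T_trms T_add] by auto
      then show ?thesis
        unfolding hilb_fun_def J_deg dim_keys_subset dimI dim_polys_deg by simp
    qed
    moreover obtain t0 where "\<forall>t\<ge>t0. rat_of_int (hilb_fun n I t) = poly p (rat_of_nat t)"
      using I(1) by (auto simp: subschemes_def)
    ultimately have "\<forall>t\<ge>max d0 t0. rat_of_int (hilb_fun n J t) = poly p (rat_of_nat t)" by simp
    then show ?thesis unfolding subschemes_def using homJ satJ by blast
  qed
  \<comment> \<open>The Gotzmann number forces the saturation to have exactly q terms in degree m;
    \<open>T\<close> has q terms there already, so saturating adds none in this degree.\<close>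
  from dim_subscheme_component[OF this r] have "card {t \<in> trms_sat n T. tdeg t = m} = q"
    unfolding J_deg dim_keys_subset q[symmetric] by simp
  moreover have "card {t \<in> T. tdeg t = m} = q"
    using dimI[of m] grass unfolding I(2)[symmetric] by (simp add: grass_def)
  moreover have "finite {t \<in> trms_sat n T. tdeg t = m}"
    by (rule finite_subset[OF _ finite_trms_deg[of n m]]) (auto simp: trms_sat_def trms_deg_def)
  moreover have "{t \<in> T. tdeg t = m} \<subseteq> {t \<in> trms_sat n T. tdeg t = m}"
    using subset_trms_sat[OF T_trms T_add] by auto
  ultimately have "{t \<in> T. tdeg t = m} = {t \<in> trms_sat n T. tdeg t = m}"
    by (intro card_subset_eq) auto
  then have J_m: "J \<inter> polys_deg n m = vs L"
    unfolding J_deg vs_def span_mon using T_deg[of m] W(2) I(2) by simp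
  show ?thesis
  proof (intro equalityI subsetI)
    fix f :: "'k mpol" assume f: "f \<in> sat n (ideal_gen n (vs L)) \<inter> polys_deg n m"
    \<comment> \<open>\<open>J\<close> is a saturated ideal containing \<open>vs L\<close>, so
      saturating the generated ideal does not leave \<open>J\<close>.\<close>
    have "ideal_gen n (vs L) \<subseteq> J"
      unfolding ideal_gen_def using homJ J_m by (auto simp: homogeneous_ideal_def)
    then have "f \<in> sat n J" using f by (auto simp: sat_def)
    then show "f \<in> vs L" using f J_m satJ by auto
  next
    fix f :: "'k mpol" assume f: "f \<in> vs L"
    then have fJ: "f \<in> polys_deg n m" using J_m by auto
    \<comment> \<open>Exponent 0 witnesses membership in the saturation.\<close>
    have "mon t * f \<in> ideal_gen n (vs L)" if "t \<in> trms_deg n 0" for t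
      using f that by (auto simp: ideal_gen_def is_ideal_def trms_deg_def polys_mon)
    then show "f \<in> sat n (ideal_gen n (vs L)) \<inter> polys_deg n m"
      using fJ polys_deg_subset_polys[of n m] by (auto simp: sat_def)
  qed
qed

end

theorem proposition6p1:
  fixes emb :: "'k::field \<Rightarrow> 'a::field"
    and prec :: "trm \<Rightarrow> trm \<Rightarrow> bool"
    and n m q r :: nat
    and p :: "rat poly"
    and Y :: "'a mpol set set"
  assumes infinite_base: "infinite (UNIV :: 'k set)"
    and extension: "field_hom emb"
    and order: "term_order n prec"
    and variables: "\<forall>i<n. prec (var_trm i) (var_trm (Suc i))"
    and gotzmann: "is_gotzmann_number TYPE('k) n p r"
    and m: "m \<ge> r"
    and q: "rat_of_nat q = rat_of_nat ((n + m) choose n) - poly p (rat_of_nat m)"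
    and Y: "GL_stable emb prec n p m q Y"
  shows "(\<forall>L \<in> borel_trms TYPE('k) prec n m q.
            (vs L :: 'k mpol set) \<in> hilb n p m q \<and>
            \<not> dominated prec n m q (vs L :: 'k mpol set)
                (double_gin emb prec n m q Y \<inter> polys_deg n m) \<longrightarrow>
            extend_scalars emb (vs L) \<notin> Y) \<and>
         (\<forall>V \<in> (hilb n p m q :: 'k mpol set set).
            \<not> dominated prec n m q
                (vs (gin emb prec n m q {extend_scalars emb V}) :: 'k mpol set)
                (double_gin emb prec n m q Y \<inter> polys_deg n m) \<longrightarrow>
            extend_scalars emb V \<notin> Y)"
proof -
  interpret ordered_terms n prec using order by unfold_locales
  let ?gin = "gin emb prec n m q Y"
  note gin = gin_dominates[OF extension Y]
  have hilb: "Y \<subseteq> hilb n p m q" using Y by (auto simp: GL_stable_def)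
  then have grass: "Y \<subseteq> grass n m q" by (auto simp: hilb_def)
  obtain W where W: "W \<in> Y" "LT W = set ?gin" using gin(2) by blast
  have comp: "double_gin emb prec n m q Y \<inter> polys_deg n m = (vs ?gin :: 'k mpol set)"
    unfolding double_gin_def
    by (rule sat_ideal_gen_vs_component[OF _ W(2) gotzmann m q]) (use W(1) hilb in blast)
  \<comment> \<open>The common core of both parts: domination holds for any exterior term whose
    coordinate is nonzero at some point of \<open>Y\<close>.\<close>
  have dom: "dominated prec n m q (vs L :: 'k mpol set) (double_gin emb prec n m q Y \<inter> polys_deg n m)"
    if "V \<in> Y" "L \<in> ext_trms prec n m q" "plucker prec n m q V L \<noteq> 0" for V L
    unfolding comp using dominatedI[OF that(2) gin(1)] gin(3)[OF that] by blast
  show ?thesis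
  proof (intro conjI ballI impI notI)
    fix L assume L: "L \<in> borel_trms TYPE('k) prec n m q" and V: "extend_scalars emb (vs L) \<in> Y"
    assume "(vs L :: 'k mpol set) \<in> hilb n p m q \<and> \<not> dominated prec n m q (vs L :: 'k mpol set)
      (double_gin emb prec n m q Y \<inter> polys_deg n m)"
    moreover have LT: "L \<in> ext_trms prec n m q" using L by (simp add: borel_trms_def)
    ultimately show False
      using dom[OF V LT plucker_extend_vs[OF extension LT]] V grass by blast
  next
    fix V :: "'k mpol set"
    assume V: "extend_scalars emb V \<in> Y" and nd: "\<not> dominated prec n m q
      (vs (gin emb prec n m q {extend_scalars emb V}) :: 'k mpol set)
      (double_gin emb prec n m q Y \<inter> polys_deg n m)"
    let ?V = "extend_scalars emb V"
    let ?L = "gin emb prec n m q {?V}"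
    let ?\<L> = "{L \<in> ext_trms prec n m q. U_open prec n m q L \<inter> orbits emb n {?V} \<noteq> {}}"
    have Vg: "?V \<in> grass n m q" using V grass by blast
    obtain M where M: "M \<in> ext_trms prec n m q" "set M = LT ?V"
      using ex_LT_list[OF Vg] by blast
    \<comment> \<open>The leading list of \<open>?V\<close> is a candidate, so \<open>gin\<close> of
      this point is a genuine maximum.\<close>
    have "?V \<in> U_open prec n m q M \<inter> orbits emb n {?V}"
      using plucker_LT_ne_0[OF Vg M] Vg subset_orbits[OF extension, of "{?V}" n m q]
      by (simp add: U_open_def)
    then have "?\<L> \<noteq> {}" using M(1) by blast
    then have L: "?L \<in> ?\<L>" by (rule gin_greatest(1))
    \<comment> \<open>The coordinate at \<open>?L\<close> is nonzero at a translate \<open>U\<close>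
      of \<open>?V\<close>, not necessarily at \<open>?V\<close> itself; stability places
      \<open>U\<close> in \<open>Y\<close>, where \<open>dom\<close> applies.\<close>
    then obtain U where U: "U \<in> U_open prec n m q ?L" "U \<in> orbits emb n {?V}" by blast
    have "U \<in> Y" using U(2) V Y by (auto simp: orbits_def GL_stable_def)
    then show False using dom[of U ?L] nd U(1) L by (auto simp: U_open_def)
  qed
qed

end
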